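(* Let $f(z)=\sum_{k\ge 0}a_kz^k\in\mathbb{Z}[[z]]$ be a generalized Liouville series with convergence radius $R_f>0$, with associated integer sequences $(s_n)_{n\ge1}$ and $(t_n)_{n\ge0}$. For $n\ge 1$ put $P_n(z)=\sum_{k=t_{n-1}}^{s_n}a_kz^k$ and $F_n(z)=\sum_{k=0}^{s_n}a_kz^k=P_1(z)+\cdots+P_n(z)$. Let $\alpha$ be a complex algebraic number with $|\alpha|<R_f$ such that $P_n(\alpha)\ne 0$ for infinitely many $n$. Let $m$ be the smallest positive integer with the following property: among the numbers $F_n(\alpha)$ $(n\ge1)$ there are infinitely many distinct algebraic numbers of degree $m$. Then $f(\alpha)\in U_m$.
   Context: Throughout, power series $f(z)=\sum_{k\ge0}a_kz^k$ have integer coefficients, positive radius of convergence $R_f$, and infinitely many non-zero coefficients. Such an $f$ is called a generalized Liouville series if there exist integer sequences $(s_n)_{n\ge1}$, $(t_n)_{n\ge0}$ such that: $0\le t_0\le s_1<t_1\le s_2<t_2\le s_3<\cdots$ (that is, $t_{n-1}\le s_n<t_n$ for all $n\ge1$); $a_k=0$ for $k<t_0$ and for $s_n<k<t_n$ ($n=1,2,\ldots$); $t_n/s_n\to\infty$ as $n\to\infty$; and the quotients $s_{n+1}/t_n$ ($n\ge1$) are bounded. For a complex algebraic number $\beta$, its minimal polynomial $M_\beta(T)\in\mathbb{Z}[T]$ is the polynomial, irreducible in the ring $\mathbb{Z}[T]$, vanishing at $\beta$ (unique up to sign); $|M_\beta|$ denotes the maximum of the absolute values of its coefficients. The degree of $\beta$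 is its degree over $\mathbb{Q}$. For a positive integer $m$, $U_m$ is the set of complex transcendental numbers $\gamma$ such that $m$ is the smallest positive integer with the property: for every $w>0$ there exist infinitely many complex algebraic numbers $\beta$ of degree $m$ satisfying $|\gamma-\beta|<|M_\beta|^{-w}$. *)

theory Defs
  imports "HOL-Analysis.Analysis" "HOL-Computational_Algebra.Computational_Algebra"
begin

definition smallest_positive :: "(nat \<Rightarrow> bool) \<Rightarrow> nat \<Rightarrow> bool" where
  "smallest_positive Q m \<longleftrightarrow> 0 < m \<and> Q m \<and> (\<forall>d. 0 < d \<and> d < m \<longrightarrow> \<not> Q d)"


section \<open>Generalized Liouville series\<close>

definition complex_fps :: "int fps \<Rightarrow> complex fps" where
  "complex_fps f = Abs_fps (\<lambda>k. of_int (fps_nth f k))"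

text \<open>
  The sequence \<open>s\<close> is indexed from 1, so the value \<open>s 0\<close> is irrelevant. All terms are
  nonnegative by the chain of inequalities starting with \<open>0 \<le> t 0\<close>, hence the type \<open>nat\<close>.
  The divisions by zero that may occur (\<open>s 0\<close> and \<open>s 1\<close>) do not affect the limit.
\<close>
definition liouville_sequences :: "int fps \<Rightarrow> (nat \<Rightarrow> nat) \<Rightarrow> (nat \<Rightarrow> nat) \<Rightarrow> bool" where
  "liouville_sequences f s t \<longleftrightarrow>
     (\<forall>n\<ge>1. t (n - 1) \<le> s n \<and> s n < t n) \<and>
     (\<forall>k<t 0. fps_nth f k = 0) \<and>
     (\<forall>n\<ge>1. \<forall>k. s n < k \<and> k < t n \<longrightarrow> fps_nth f k = 0) \<and>
     filterlim (\<lambda>n. real (t n) / real (s n)) at_top sequentially \<and>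
     bounded ((\<lambda>n. real (s (n + 1)) / real (t n)) ` {1..})"

definition generalized_liouville_series :: "int fps \<Rightarrow> bool" where
  "generalized_liouville_series f \<longleftrightarrow>
     fps_conv_radius (complex_fps f) > 0 \<and>
     infinite {k. fps_nth f k \<noteq> 0} \<and>
     (\<exists>s t. liouville_sequences f s t)"

definition block :: "int fps \<Rightarrow> (nat \<Rightarrow> nat) \<Rightarrow> (nat \<Rightarrow> nat) \<Rightarrow> nat \<Rightarrow> complex \<Rightarrow> complex" where
  "block f s t n z = (\<Sum>k=t (n - 1)..s n. of_int (fps_nth f k) * z ^ k)"

definition truncation :: "int fps \<Rightarrow> (nat \<Rightarrow> nat) \<Rightarrow> nat \<Rightarrow> complex \<Rightarrow> complex" where
  "truncation f s n z = (\<Sum>k=0..s n. of_int (fps_nth f k) * z ^ k)"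


section \<open>Algebraic numbers and the sets \<open>U\<^sub>m\<close>\<close>

text \<open>
  \<^const>\<open>irreducible\<close> refers to the ring of the coefficients: over \<^typ>\<open>int\<close> it forces the
  polynomial to be primitive, which determines it up to sign.
\<close>
definition is_int_min_poly :: "int poly \<Rightarrow> complex \<Rightarrow> bool" where
  "is_int_min_poly M \<beta> \<longleftrightarrow> irreducible M \<and> poly (map_poly of_int M) \<beta> = 0"

definition poly_height :: "int poly \<Rightarrow> int" where
  "poly_height M = Max (abs ` set (coeffs M))"

text \<open>
  \<open>\<beta>\<close> is algebraic and its minimal polynomial over the rationals (up to a scalar) has degree \<open>d\<close>.
\<close>
definition algebraic_of_degree :: "complex \<Rightarrow> nat \<Rightarrow> bool" where
  "algebraic_of_degree \<beta> d \<longleftrightarrow>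
     (\<exists>p :: rat poly. irreducible p \<and> poly (map_poly of_rat p) \<beta> = 0 \<and> degree p = d)"

definition well_approximable :: "complex \<Rightarrow> nat \<Rightarrow> bool" where
  "well_approximable \<gamma> d \<longleftrightarrow>
     (\<forall>w::real. w > 0 \<longrightarrow>
        infinite {\<beta>. algebraic_of_degree \<beta> d \<and>
          (\<exists>M. is_int_min_poly M \<beta> \<and>
               cmod (\<gamma> - \<beta>) < real_of_int (poly_height M) powr (- w))})"

definition U_numbers :: "nat \<Rightarrow> complex set" where
  "U_numbers m = {\<gamma>. \<not> algebraic \<gamma> \<and> smallest_positive (well_approximable \<gamma>) m}"

end

theory Submission
  imports Defs
begin

text \<open>
Let \<open>\<gamma> = f(\<alpha>)\<close> and let \<open>\<beta>\<^sub>n\<close> be the truncation of \<open>f\<close> at \<open>s\<^sub>n\<close>, evaluated at \<open>\<alpha>\<close>.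
Because of the gap after \<open>s\<^sub>n\<close>, the error \<open>\<gamma> - \<beta>\<^sub>n\<close> is at most \<open>C q^t\<^sub>n\<close> with some \<open>q < 1\<close>
(\<open>truncation_error\<close>). On the other hand \<open>\<beta>\<^sub>n\<close> is the value at the fixed algebraic number \<open>\<alpha>\<close> of an
integer polynomial whose degree is at most \<open>s\<^sub>n\<close> and whose coefficients are at most exponential in
\<open>s\<^sub>n\<close>. Hence the degree of \<open>\<beta>\<^sub>n\<close> is bounded and the height of its minimal polynomial is at most
exponential in \<open>s\<^sub>n\<close> (\<open>\<beta>_min_poly\<close>). As \<open>t\<^sub>n / s\<^sub>n\<close> tends to infinity, the error eventually beats
every fixed power of every exponential in \<open>s\<^sub>n\<close> (\<open>decay\<close>). This makes every degree that is attained
by infinitely many distinct \<open>\<beta>\<^sub>n\<close> a degree in which \<open>\<gamma>\<close> is well approximable, and a least such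
degree \<open>m\<close> exists by the pigeonhole principle.

The converse bounds come from Liouville's inequality: if \<open>Q(\<alpha>) \<noteq> 0\<close> for an integer polynomial \<open>Q\<close>,
then \<open>\<bar>Q(\<alpha>)\<bar>\<close> is at least \<open>c^(1 + deg Q) / (length of Q)^E\<close> with positive constants that depend on \<open>\<alpha>\<close> only
(\<open>liouville_inequality\<close>). Apply it to the composition of an integer polynomial \<open>M\<close> with the
truncation polynomial: unless \<open>M\<close> vanishes at \<open>\<beta>\<^sub>n\<close>, a root \<open>\<xi>\<close> of \<open>M\<close> cannot be much closer to
\<open>\<beta>\<^sub>n\<close> than an exponential in \<open>-s\<^sub>n\<close> times a fixed negative power of the height of \<open>M\<close>
(\<open>separation\<close>). If \<open>\<gamma>\<close> were algebraic, \<open>\<xi> = \<gamma>\<close> would contradict the error bound, since the \<open>\<beta>\<^sub>n\<close>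
take infinitely many values. So \<open>\<gamma>\<close> is transcendental, each value is taken finitely often, and
from some index on every \<open>\<beta>\<^sub>n\<close> has degree at least \<open>m\<close>. Now let \<open>\<xi>\<close> have degree \<open>d < m\<close> and
height \<open>h\<close>. Its minimal polynomial cannot vanish at \<open>\<beta>\<^sub>n\<close>, so separation holds for every large
\<open>n\<close>. The boundedness of \<open>s\<^sub>n\<^sub>+\<^sub>1 / t\<^sub>n\<close> allows the choice of an \<open>n\<close> with \<open>t\<^sub>n\<close> large enough for
\<open>\<gamma> - \<beta>\<^sub>n\<close> to be negligible and yet with \<open>s\<^sub>n\<close> of order \<open>log h\<close>. Then \<open>\<bar>\<gamma> - \<xi>\<bar>\<close> is at least a
fixed negative power of \<open>h\<close>, up to a constant, so \<open>\<gamma>\<close> is not well approximable in degree \<open>d\<close>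
(\<open>not_well_approximable_below\<close>).

Both the lower bounds and the upper bounds for heights rest on pseudo-division of integer polynomials
with control of the coefficients (\<open>pseudo_division\<close>), which reduces values at \<open>\<alpha>\<close> of polynomials of
large degree to values of polynomials of bounded degree.
\<close>

section \<open>Integer polynomials at complex points and their length\<close>

abbreviation cpoly :: "int poly \<Rightarrow> complex poly" where
  "cpoly p \<equiv> map_poly of_int p"

abbreviation ev :: "int poly \<Rightarrow> complex \<Rightarrow> complex" where
  "ev p x \<equiv> poly (cpoly p) x"

lemma cpoly_add: "cpoly (p + q) = cpoly p + cpoly q"
  by (rule poly_eqI) (simp add: coeff_map_poly)

lemma cpoly_diff: "cpoly (p - q) = cpoly p - cpoly q"
  by (rule poly_eqI) (simp add: coeff_map_poly)

lemma cpoly_smult: "cpoly (smult a p) = smult (of_int a) (cpoly p)"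
  by (rule poly_eqI) (simp add: coeff_map_poly)

lemma cpoly_mult: "cpoly (p * q) = cpoly p * cpoly q"
  by (induction p) (simp_all add: cpoly_add cpoly_smult map_poly_pCons)

lemma cpoly_monom: "cpoly (monom a n) = monom (of_int a) n"
  by (simp add: map_poly_monom)

lemma cpoly_power: "cpoly (p ^ n) = cpoly p ^ n"
  by (induction n) (simp_all add: cpoly_mult)

lemma cpoly_sum: "cpoly (\<Sum>i\<in>A. p i) = (\<Sum>i\<in>A. cpoly (p i))"
  by (induction A rule: infinite_finite_induct) (simp_all add: cpoly_add)

lemma cpoly_pcompose: "cpoly (pcompose p q) = pcompose (cpoly p) (cpoly q)"
  by (induction p) (simp_all add: pcompose_pCons cpoly_add cpoly_mult map_poly_pCons)

lemma degree_cpoly: "degree (cpoly p) = degree p"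
  by (rule degree_map_poly) auto

lemma cpoly_eq_0_iff: "cpoly p = 0 \<longleftrightarrow> p = 0"
  by (rule map_poly_eq_0_iff) auto

lemmas cpoly_simps = cpoly_add cpoly_diff cpoly_smult cpoly_mult cpoly_monom cpoly_power
  cpoly_sum cpoly_pcompose map_poly_pCons

text \<open>
The sum of the absolute values of the coefficients is used instead of their maximum because it is
submultiplicative. Lengths of complex polynomials enter when an integer polynomial is split into
linear factors.
\<close>
definition poly_length :: "complex poly \<Rightarrow> real" where
  "poly_length p = sum_list (map norm (coeffs p))"

abbreviation len :: "int poly \<Rightarrow> real" where
  "len p \<equiv> poly_length (cpoly p)"

lemma poly_length_0 [simp]: "poly_length 0 = 0"
  by (simp add: poly_length_def)

lemma poly_length_pCons [simp]: "poly_length (pCons a p) = norm a + poly_length p"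
  by (cases "a = 0 \<and> p = 0") (auto simp: poly_length_def cCons_def)

lemma poly_length_nonneg [simp]: "poly_length p \<ge> 0"
  by (induction p) simp_all

lemma poly_length_add: "poly_length (p + q) \<le> poly_length p + poly_length q"
proof (induction p q rule: poly_induct2)
  case (pCons a p b q)
  then show ?case using norm_triangle_ineq[of a b] by simp
qed simp

lemma poly_length_smult [simp]: "poly_length (smult a p) = norm a * poly_length p"
  by (induction p) (simp_all add: norm_mult algebra_simps)

lemma poly_length_diff: "poly_length (p - q) \<le> poly_length p + poly_length q"
  using poly_length_add[of p "- q"] poly_length_smult[of "-1" q] by simp

lemma poly_length_mult: "poly_length (p * q) \<le> poly_length p * poly_length q"
proof (induction p)
  case (pCons a p)
  have "poly_length (pCons a p * q) \<le> norm a * poly_length q + poly_length (p * q)"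
    using poly_length_add[of "smult a q" "pCons 0 (p * q)"] by simp
  also have "\<dots> \<le> poly_length (pCons a p) * poly_length q"
    using pCons.IH by (simp add: algebra_simps)
  finally show ?case .
qed simp

lemma poly_length_monom [simp]: "poly_length (monom a n) = norm a"
  by (induction n) (simp_all add: monom_0 monom_Suc)

lemma poly_length_one [simp]: "poly_length 1 = 1"
  by (simp add: poly_length_def)

lemma poly_length_power: "poly_length (p ^ n) \<le> poly_length p ^ n"
proof (induction n)
  case (Suc n)
  have "poly_length (p ^ Suc n) \<le> poly_length p * poly_length (p ^ n)"
    by (simp add: poly_length_mult)
  also have "\<dots> \<le> poly_length p * poly_length p ^ n"
    by (intro mult_left_mono Suc.IH) simp
  finally show ?case by simp
qed simp

lemma poly_length_sum: "poly_length (\<Sum>i\<in>A. p i) \<le> (\<Sum>i\<in>A. poly_length (p i))"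
proof (induction A rule: infinite_finite_induct)
  case (insert x A)
  then show ?case using poly_length_add[of "p x" "\<Sum>i\<in>A. p i"] by simp
qed simp_all

lemma norm_coeff_le_poly_length: "norm (coeff p i) \<le> poly_length p"
proof (induction p arbitrary: i)
  case (pCons a p)
  have "norm (coeff p j) \<le> norm a + poly_length p" for j
    using pCons.IH[of j] norm_ge_zero[of a] by linarith
  then show ?case by (cases i) simp_all
qed simp

lemma abs_coeff_le_len: "\<bar>real_of_int (coeff p i)\<bar> \<le> len p"
  using norm_coeff_le_poly_length[of "cpoly p" i] by (simp add: coeff_map_poly)

lemma one_le_len:
  assumes "p \<noteq> 0"
  shows "1 \<le> len p"
proof -
  have "lead_coeff p \<noteq> 0" using assms by simp
  then have "1 \<le> \<bar>real_of_int (lead_coeff p)\<bar>" by linarith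
  then show ?thesis using abs_coeff_le_len[of p "degree p"] by linarith
qed

lemma poly_length_eq_sum: "degree p \<le> n \<Longrightarrow> poly_length p = (\<Sum>i\<le>n. norm (coeff p i))"
proof (induction p arbitrary: n)
  case (pCons a p)
  show ?case
  proof (cases n)
    case 0
    then have "p = 0" using pCons.prems by (simp split: if_splits)
    then show ?thesis using 0 by simp
  next
    case (Suc k)
    then have "degree p \<le> k" using pCons.prems by (simp split: if_splits)
    then show ?thesis using pCons.IH[of k] Suc by (simp add: sum.atMost_Suc_shift del: sum.atMost_Suc)
  qed
qed simp

lemma len_eq_sum: "degree p \<le> n \<Longrightarrow> len p = (\<Sum>i\<le>n. \<bar>real_of_int (coeff p i)\<bar>)"
  using poly_length_eq_sum[of "cpoly p" n] by (simp add: degree_cpoly coeff_map_poly)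

lemma norm_poly_le_poly_length:
  assumes "norm x \<le> 1"
  shows "norm (poly p x) \<le> poly_length p"
proof (induction p)
  case (pCons a p)
  have "norm (poly (pCons a p) x) \<le> norm a + norm x * norm (poly p x)"
    using norm_triangle_ineq[of a "x * poly p x"] by (simp add: norm_mult)
  also have "norm x * norm (poly p x) \<le> 1 * poly_length p"
    using assms pCons.IH by (intro mult_mono) auto
  finally show ?case by simp
qed simp

lemma norm_poly_le_poly_length_power:
  assumes "norm x \<le> r" "1 \<le> r"
  shows "norm (poly p x) \<le> poly_length p * r ^ degree p"
proof (induction p)
  case (pCons a p)
  show ?case
  proof (cases "p = 0")
    case False
    have 1: "1 \<le> r ^ Suc (degree p)" using assms by (intro one_le_power)
    have "norm (poly (pCons a p) x) \<le> norm a + norm x * norm (poly p x)"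
      using norm_triangle_ineq[of a "x * poly p x"] by (simp add: norm_mult)
    also have "norm x * norm (poly p x) \<le> r * (poly_length p * r ^ degree p)"
      using assms pCons.IH by (intro mult_mono) auto
    also have "norm a + r * (poly_length p * r ^ degree p)
        \<le> norm a * r ^ Suc (degree p) + r * (poly_length p * r ^ degree p)"
      using mult_left_mono[OF 1, of "norm a"] by simp
    finally show ?thesis using False by (simp add: algebra_simps)
  qed simp
qed simp

lemma norm_poly_diff_le:
  assumes "norm x \<le> r" "norm y \<le> r" "1 \<le> r"
  shows "norm (poly p x - poly p y) \<le> norm (x - y) * poly_length p * degree p * r ^ degree p"
proof (induction p)
  case (pCons a p)
  show ?case
  proof (cases "p = 0")
    case False
    define d where "d = degree p"
    define L where "L = poly_length p"
    have L: "0 \<le> L" by (simp add: L_def)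
    have r: "r ^ d \<le> r ^ Suc d" using assms by (intro power_increasing) auto
    have "poly (pCons a p) x - poly (pCons a p) y = (x - y) * poly p x + y * (poly p x - poly p y)"
      by (simp add: algebra_simps)
    then have "norm (poly (pCons a p) x - poly (pCons a p) y)
        \<le> norm (x - y) * norm (poly p x) + norm y * norm (poly p x - poly p y)"
      by (metis norm_mult norm_triangle_ineq)
    also have "\<dots> \<le> norm (x - y) * (L * r ^ d) + r * (norm (x - y) * L * d * r ^ d)"
      using assms pCons.IH norm_poly_le_poly_length_power[OF assms(1,3), of p]
      unfolding L_def d_def by (intro add_mono mult_mono mult_left_mono) auto
    also have "\<dots> \<le> norm (x - y) * (L * r ^ Suc d) + r * (norm (x - y) * L * d * r ^ d)"
      using L r by (intro add_right_mono mult_left_mono) auto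
    also have "\<dots> = norm (x - y) * L * Suc d * r ^ Suc d" by (simp add: algebra_simps)
    also have "\<dots> \<le> norm (x - y) * (norm a + L) * Suc d * r ^ Suc d"
      using assms by (intro mult_right_mono mult_left_mono) auto
    finally show ?thesis using False by (simp add: L_def d_def)
  qed simp
qed simp

lemma poly_length_pcompose_le:
  assumes "poly_length q \<le> Y" "1 \<le> Y"
  shows "poly_length (pcompose p q) \<le> poly_length p * Y ^ degree p"
proof (induction p)
  case (pCons a p)
  show ?case
  proof (cases "p = 0")
    case False
    have 1: "1 \<le> Y ^ Suc (degree p)" using assms by (intro one_le_power)
    have "poly_length (pcompose (pCons a p) q) \<le> norm a + poly_length q * poly_length (pcompose p q)"
      using poly_length_add[of "[:a:]" "q * pcompose p q"] poly_length_mult[of q "pcompose p q"]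
      by (simp add: pcompose_pCons)
    also have "poly_length q * poly_length (pcompose p q) \<le> Y * (poly_length p * Y ^ degree p)"
      using assms pCons.IH by (intro mult_mono) auto
    also have "norm a + Y * (poly_length p * Y ^ degree p)
        \<le> norm a * Y ^ Suc (degree p) + Y * (poly_length p * Y ^ degree p)"
      using mult_left_mono[OF 1, of "norm a"] by simp
    finally show ?thesis using False by (simp add: algebra_simps)
  qed simp
qed simp

lemma one_le_poly_height:
  assumes "M \<noteq> 0"
  shows "1 \<le> poly_height M"
proof -
  have "lead_coeff M \<in> set (coeffs M)" using assms by (simp add: coeffs_def)
  then have "\<bar>lead_coeff M\<bar> \<le> poly_height M" unfolding poly_height_def by (intro Max_ge) auto
  moreover have "lead_coeff M \<noteq> 0" using assms by simp
  ultimately show ?thesis by linarith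
qed

lemma abs_coeff_le_poly_height:
  assumes "M \<noteq> 0"
  shows "\<bar>coeff M i\<bar> \<le> poly_height M"
proof (cases "i \<le> degree M")
  case True
  then have "coeff M i \<in> set (coeffs M)" using assms by (simp add: coeff_in_coeffs)
  then show ?thesis unfolding poly_height_def by (intro Max_ge) auto
next
  case False
  then show ?thesis using one_le_poly_height[OF assms] by (simp add: coeff_eq_0)
qed

lemma poly_height_le_len:
  assumes "M \<noteq> 0"
  shows "poly_height M \<le> len M"
proof -
  have "poly_height M \<in> abs ` set (coeffs M)"
    unfolding poly_height_def using assms by (intro Max_in) auto
  then obtain i where "poly_height M = \<bar>coeff M i\<bar>"
    using assms by (auto simp: coeffs_def)
  then show ?thesis using abs_coeff_le_len[of M i] by simp
qed

lemma len_le_poly_height: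
  assumes "M \<noteq> 0"
  shows "len M \<le> (degree M + 1) * poly_height M"
proof -
  have "len M = (\<Sum>i\<le>degree M. \<bar>real_of_int (coeff M i)\<bar>)" by (rule len_eq_sum) simp
  also have "\<dots> \<le> (\<Sum>i\<le>degree M. real_of_int (poly_height M))"
  proof (rule sum_mono)
    fix i
    show "\<bar>real_of_int (coeff M i)\<bar> \<le> poly_height M"
      using abs_coeff_le_poly_height[OF assms, of i] by linarith
  qed
  finally show ?thesis by simp
qed

lemma finite_bounded_height_polys:
  "finite {M :: int poly. M \<noteq> 0 \<and> degree M \<le> d \<and> poly_height M \<le> K}"
proof -
  have "{M :: int poly. M \<noteq> 0 \<and> degree M \<le> d \<and> poly_height M \<le> K}
      \<subseteq> Poly ` {xs. set xs \<subseteq> {-K..K} \<and> length xs \<le> Suc d}"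
  proof
    fix M :: "int poly"
    assume "M \<in> {M. M \<noteq> 0 \<and> degree M \<le> d \<and> poly_height M \<le> K}"
    then have M: "M \<noteq> 0" "degree M \<le> d" "poly_height M \<le> K" by auto
    have "set (coeffs M) \<subseteq> {-K..K}"
    proof
      fix c assume "c \<in> set (coeffs M)"
      then obtain i where "c = coeff M i" using M(1) by (auto simp: coeffs_def)
      then show "c \<in> {-K..K}" using abs_coeff_le_poly_height[OF M(1), of i] M(3) by auto
    qed
    moreover have "length (coeffs M) \<le> Suc d" using M by (simp add: length_coeffs)
    ultimately have "coeffs M \<in> {xs. set xs \<subseteq> {-K..K} \<and> length xs \<le> Suc d}" by blast
    then show "M \<in> Poly ` {xs. set xs \<subseteq> {-K..K} \<and> length xs \<le> Suc d}"
      by (rule rev_image_eqI) simp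
  qed
  then show ?thesis
    by (rule finite_subset) (intro finite_imageI finite_lists_length_le, simp)
qed

lemma finite_roots_bounded_height:
  "finite {\<beta>. \<exists>M. M \<noteq> 0 \<and> degree M \<le> d \<and> poly_height M \<le> K \<and> ev M \<beta> = 0}"
proof -
  have "{\<beta>. \<exists>M. M \<noteq> 0 \<and> degree M \<le> d \<and> poly_height M \<le> K \<and> ev M \<beta> = 0}
     = (\<Union>M\<in>{M. M \<noteq> 0 \<and> degree M \<le> d \<and> poly_height M \<le> K}. {\<beta>. ev M \<beta> = 0})" by auto
  then show ?thesis
    using finite_bounded_height_polys by (auto intro!: finite_UN_I poly_roots_finite simp: cpoly_eq_0_iff)
qed

section \<open>Minimal annihilating polynomials and degrees\<close>

text \<open>
Only the degree is minimized, so the polynomial is determined up to a rational factor. This is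
enough to measure degrees, and it makes every remainder of a pseudo-division by the polynomial that
vanishes at the point equal to zero.
\<close>
definition minimal_annihilator :: "int poly \<Rightarrow> complex \<Rightarrow> bool" where
  "minimal_annihilator A x \<longleftrightarrow> A \<noteq> 0 \<and> ev A x = 0 \<and>
     (\<forall>B. B \<noteq> 0 \<and> ev B x = 0 \<longrightarrow> degree A \<le> degree B)"

lemma minimal_annihilator_exists:
  assumes "N \<noteq> 0" "ev N x = 0"
  obtains A where "minimal_annihilator A x"
proof -
  obtain A where "A \<noteq> 0 \<and> ev A x = 0" "\<forall>B. B \<noteq> 0 \<and> ev B x = 0 \<longrightarrow> degree A \<le> degree B"
    using ex_has_least_nat[of "\<lambda>B. B \<noteq> 0 \<and> ev B x = 0" N degree] assms by blast
  then show ?thesis using that by (auto simp: minimal_annihilator_def)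
qed

lemma minimal_annihilator_degree_unique:
  "minimal_annihilator A x \<Longrightarrow> minimal_annihilator B x \<Longrightarrow> degree A = degree B"
  unfolding minimal_annihilator_def by (intro order_antisym) blast+

lemma degree_pos_if_ev_eq_0:
  assumes "N \<noteq> 0" "ev N x = 0"
  shows "0 < degree N"
proof (rule ccontr)
  assume "\<not> 0 < degree N"
  then obtain a where "N = [:a:]" by (metis degree_eq_zeroE neq0_conv)
  then show False using assms by (simp add: map_poly_pCons)
qed

lemma annihilator_imp_algebraic: "N \<noteq> 0 \<Longrightarrow> ev N x = 0 \<Longrightarrow> algebraic x"
  by (rule algebraicI[of "cpoly N"]) (auto simp: coeff_map_poly cpoly_eq_0_iff)

section \<open>Pseudo-division with length control\<close>

text \<open>
Each step of the division multiplies the dividend by the leading coefficient of \<open>R\<close> and subtracts a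
multiple of \<open>R\<close>, which increases the length by a factor of at most \<open>2 * len R\<close>. The constant \<open>3\<close>
leaves room for the monomial that is added to the quotient in the same step.
\<close>
lemma pseudo_division_bound:
  fixes R P :: "int poly"
  assumes "R \<noteq> 0" and "\<And>i. i \<ge> degree R + n \<Longrightarrow> coeff P i = 0"
  shows "\<exists>S T. smult (lead_coeff R ^ n) P = S * R + T \<and> (\<forall>i\<ge>degree R. coeff T i = 0) \<and>
     len S \<le> (3 * len R) ^ n * len P \<and> len T \<le> (3 * len R) ^ n * len P"
  using assms(2)
proof (induction n arbitrary: P)
  case 0
  then show ?case by (intro exI[of _ 0] exI[of _ P]) auto
next
  case (Suc n)
  define b where "b = lead_coeff R"
  define p where "p = coeff P (degree R + n)"
  define P' where "P' = smult b P - monom p n * R"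
  have L: "1 \<le> len R" using assms(1) by (rule one_le_len)
  have "coeff P' i = 0" if "i \<ge> degree R + n" for i
  proof (cases "i = degree R + n")
    case True
    then show ?thesis by (simp add: P'_def b_def p_def coeff_monom_mult)
  next
    case False
    then have "coeff P i = 0" "i - n > degree R" using Suc.prems that by auto
    then show ?thesis by (simp add: P'_def coeff_monom_mult coeff_eq_0)
  qed
  from Suc.IH[OF this] obtain S T where
    ST: "smult (b ^ n) P' = S * R + T" "\<forall>i\<ge>degree R. coeff T i = 0"
    "len S \<le> (3 * len R) ^ n * len P'" "len T \<le> (3 * len R) ^ n * len P'"
    unfolding b_def by blast
  have b: "\<bar>real_of_int b\<bar> \<le> len R" unfolding b_def by (rule abs_coeff_le_len)
  have p: "\<bar>real_of_int p\<bar> \<le> len P" unfolding p_def by (rule abs_coeff_le_len)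
  have "len P' \<le> len (smult b P) + len (monom p n * R)"
    unfolding P'_def cpoly_diff by (rule poly_length_diff)
  also have "len (smult b P) = \<bar>real_of_int b\<bar> * len P" by (simp add: cpoly_smult)
  also have "\<bar>real_of_int b\<bar> * len P \<le> len R * len P" using b by (intro mult_right_mono) auto
  also have "len (monom p n * R) \<le> \<bar>real_of_int p\<bar> * len R"
    using poly_length_mult[of "cpoly (monom p n)" "cpoly R"] by (simp add: cpoly_mult cpoly_monom)
  also have "\<bar>real_of_int p\<bar> * len R \<le> len P * len R" using p by (intro mult_right_mono) auto
  finally have P': "len P' \<le> 2 * len R * len P" by (simp add: mult_ac)
  have pow: "0 \<le> (3 * len R) ^ n" by simp
  have bound: "(3 * len R) ^ n * len P' + len R ^ n * len P \<le> (3 * len R) ^ Suc n * len P"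
  proof -
    have "(3 * len R) ^ n * len P' \<le> (3 * len R) ^ n * (2 * len R * len P)"
      using P' pow by (intro mult_left_mono)
    moreover have "len R ^ n * len P \<le> (3 * len R) ^ n * (len R * len P)"
    proof (intro mult_mono power_mono)
      show "len P \<le> len R * len P"
        using mult_right_mono[OF L, of "len P"] by simp
    qed (use L in auto)
    moreover have "(3 * len R) ^ Suc n * len P
        = (3 * len R) ^ n * (2 * len R * len P) + (3 * len R) ^ n * (len R * len P)"
      by (simp add: algebra_simps)
    ultimately show ?thesis by linarith
  qed
  define S' where "S' = S + monom (b ^ n * p) n"
  have "smult (b ^ Suc n) P = smult (b ^ n) P' + smult (b ^ n) (monom p n) * R"
    by (simp add: P'_def smult_diff_right algebra_simps)
  also have "\<dots> = S' * R + T"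
    unfolding ST(1) S'_def by (simp add: algebra_simps smult_monom)
  finally have "smult (b ^ Suc n) P = S' * R + T" .
  moreover have "len S' \<le> (3 * len R) ^ Suc n * len P"
  proof -
    have "len S' \<le> len S + \<bar>real_of_int b\<bar> ^ n * \<bar>real_of_int p\<bar>"
      using poly_length_add[of "cpoly S" "cpoly (monom (b ^ n * p) n)"]
      by (simp add: S'_def cpoly_add cpoly_monom norm_mult norm_power)
    also have "\<bar>real_of_int b\<bar> ^ n * \<bar>real_of_int p\<bar> \<le> len R ^ n * len P"
      using b p by (intro mult_mono power_mono) auto
    finally show ?thesis using ST(3) bound by linarith
  qed
  moreover have "len T \<le> (3 * len R) ^ Suc n * len P"
  proof -
    have "0 \<le> len R ^ n * len P" by simp
    then show ?thesis using ST(4) bound by linarith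
  qed
  ultimately show ?case using ST(2) unfolding b_def by blast
qed

corollary pseudo_division:
  fixes R P :: "int poly"
  assumes "R \<noteq> 0" and "degree P < degree R + n"
  obtains S T where "smult (lead_coeff R ^ n) P = S * R + T" "T = 0 \<or> degree T < degree R"
     "\<forall>i\<ge>degree R. coeff T i = 0"
     "len S \<le> (3 * len R) ^ n * len P" "len T \<le> (3 * len R) ^ n * len P"
proof -
  have "\<exists>S T. smult (lead_coeff R ^ n) P = S * R + T \<and> (\<forall>i\<ge>degree R. coeff T i = 0) \<and>
     len S \<le> (3 * len R) ^ n * len P \<and> len T \<le> (3 * len R) ^ n * len P"
    using assms by (intro pseudo_division_bound) (auto simp: coeff_eq_0)
  then obtain S T where "smult (lead_coeff R ^ n) P = S * R + T" "\<forall>i\<ge>degree R. coeff T i = 0"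
     "len S \<le> (3 * len R) ^ n * len P" "len T \<le> (3 * len R) ^ n * len P" by blast
  moreover from this(2) have "T = 0 \<or> degree T < degree R"
    by (metis leading_coeff_0_iff not_less)
  ultimately show ?thesis using that by blast
qed

section \<open>Liouville's inequality\<close>

text \<open>
The proof is a Euclidean descent on the degree. Pseudo-division of \<open>A\<close> by \<open>R\<close> gives a remainder \<open>T\<close>
of smaller degree with \<open>S(\<alpha>) R(\<alpha>) = -T(\<alpha>)\<close>, so a lower bound for \<open>\<bar>T(\<alpha>)\<bar>\<close> and the trivial upper
bound for \<open>\<bar>S(\<alpha>)\<bar>\<close> give a lower bound for \<open>\<bar>R(\<alpha>)\<bar>\<close>. The descent ends at the nonzero integer
constants. The constants depend on the degree bound \<open>k\<close>, which is harmless because only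
degrees less than that of \<open>A\<close> matter.
\<close>
lemma liouville_bounded_degree:
  assumes A: "minimal_annihilator A \<alpha>" and \<alpha>: "norm \<alpha> \<le> 1"
  shows "\<exists>c>0. \<exists>E. \<forall>R. ev R \<alpha> \<noteq> 0 \<and> degree R \<le> k \<and> degree R < degree A \<longrightarrow>
     c \<le> norm (ev R \<alpha>) * len R ^ E"
proof (induction k)
  case 0
  have "1 \<le> norm (ev R \<alpha>) * len R ^ 0" if R0: "ev R \<alpha> \<noteq> 0" "degree R \<le> 0" for R
  proof -
    obtain a where R: "R = [:a:]" using R0(2) by (metis degree_eq_zeroE le_zero_eq)
    then have "a \<noteq> 0" using R0(1) by auto
    then have "1 \<le> \<bar>real_of_int a\<bar>" by linarith
    then show ?thesis by (simp add: R map_poly_pCons)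
  qed
  then show ?case by (intro exI[of _ 1] conjI exI[of _ 0]) auto
next
  case (Suc k)
  then obtain c E where c: "0 < c" and
    IH: "\<And>R. ev R \<alpha> \<noteq> 0 \<Longrightarrow> degree R \<le> k \<Longrightarrow> degree R < degree A \<Longrightarrow>
        c \<le> norm (ev R \<alpha>) * len R ^ E" by blast
  have A0: "A \<noteq> 0" "ev A \<alpha> = 0" and
    Amin: "\<And>B. B \<noteq> 0 \<Longrightarrow> ev B \<alpha> = 0 \<Longrightarrow> degree A \<le> degree B"
    using A by (auto simp: minimal_annihilator_def)
  define n where "n = degree A + 1"
  define a where "a = 3 ^ n * len A"
  have a: "1 \<le> a" unfolding a_def using one_le_len[OF A0(1)] 
    by (metis mult_mono' mult_1 one_le_power one_le_numeral zero_le_one)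
  define c' where "c' = c / a ^ (E + 1)"
  define E' where "E' = n * (E + 1)"
  have c': "0 < c'" using c a by (simp add: c'_def)
  have new: "c' \<le> norm (ev R \<alpha>) * len R ^ E'"
    if R: "ev R \<alpha> \<noteq> 0" "degree R = Suc k" "degree R < degree A" for R
  proof -
    have R0: "R \<noteq> 0" using R by auto
    have dA: "degree A < degree R + n" by (simp add: n_def)
    obtain S T where ST: "smult (lead_coeff R ^ n) A = S * R + T" "T = 0 \<or> degree T < degree R"
     "len S \<le> (3 * len R) ^ n * len A" "len T \<le> (3 * len R) ^ n * len A"
      by (rule pseudo_division[OF R0 dA])
    have eq: "ev S \<alpha> * ev R \<alpha> + ev T \<alpha> = 0"
      using arg_cong[OF ST(1), of "\<lambda>p. ev p \<alpha>"] A0 by (simp add: cpoly_simps)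
    \<comment> \<open>Otherwise T is zero by minimality, R divides a multiple of A, and the cofactor S would be an
      annihilator of \<open>\<alpha>\<close> of degree less than that of A.\<close>
    have T0: "ev T \<alpha> \<noteq> 0"
    proof
      assume T: "ev T \<alpha> = 0"
      then have "T = 0" using Amin[of T] ST(2) R(3) by linarith
      then have SR: "smult (lead_coeff R ^ n) A = S * R" using ST(1) by simp
      then have S: "S \<noteq> 0" using A0 R0 by auto
      have "ev S \<alpha> = 0" using eq T R(1) by simp
      then have "degree A \<le> degree S" using Amin S by blast
      moreover have "degree A = degree S + degree R"
        using arg_cong[OF SR, of degree] S R0 by (simp add: degree_mult_eq)
      ultimately show False using R(2) by simp
    qed
    define X where "X = a * len R ^ n"
    have X: "len S \<le> X" "len T \<le> X"
      using ST by (simp_all add: X_def a_def power_mult_distrib mult_ac)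
    have X0: "0 \<le> X" using X(1) poly_length_nonneg[of "cpoly S"] by linarith
    have "c \<le> norm (ev T \<alpha>) * len T ^ E"
      using T0 ST(2) R by (intro IH) auto
    also have "ev T \<alpha> = - (ev S \<alpha> * ev R \<alpha>)" using eq by (simp add: eq_neg_iff_add_eq_0 add.commute)
    also have "norm (- (ev S \<alpha> * ev R \<alpha>)) = norm (ev S \<alpha>) * norm (ev R \<alpha>)"
      by (simp add: norm_mult)
    also have "\<dots> * len T ^ E \<le> X * norm (ev R \<alpha>) * X ^ E"
      using X X0 norm_poly_le_poly_length[OF \<alpha>, of "cpoly S"]
      by (intro mult_mono power_mono) auto
    also have "\<dots> = norm (ev R \<alpha>) * X ^ (E + 1)" by simp
    also have "X ^ (E + 1) = a ^ (E + 1) * len R ^ E'"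
      unfolding X_def E'_def power_mult_distrib power_mult ..
    also have "norm (ev R \<alpha>) * (a ^ (E + 1) * len R ^ E') = norm (ev R \<alpha>) * len R ^ E' * a ^ (E + 1)"
      by (simp only: mult_ac)
    finally show ?thesis unfolding c'_def using a by (simp add: divide_le_eq)
  qed
  have "min c c' \<le> norm (ev R \<alpha>) * len R ^ max E E'"
    if R: "ev R \<alpha> \<noteq> 0" "degree R \<le> Suc k" "degree R < degree A" for R
  proof -
    have "R \<noteq> 0" using R by auto
    then have L: "1 \<le> len R" by (rule one_le_len)
    have "norm (ev R \<alpha>) * len R ^ E \<le> norm (ev R \<alpha>) * len R ^ max E E'"
      "norm (ev R \<alpha>) * len R ^ E' \<le> norm (ev R \<alpha>) * len R ^ max E E'"
      using L by (auto intro!: mult_left_mono power_increasing)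
    moreover consider "degree R \<le> k" | "degree R = Suc k" using R by linarith
    then have "c \<le> norm (ev R \<alpha>) * len R ^ E \<or> c' \<le> norm (ev R \<alpha>) * len R ^ E'"
      using IH[of R] new[of R] R by cases auto
    ultimately show ?thesis by linarith
  qed
  then show ?case using c c' by (intro exI[of _ "min c c'"] conjI exI[of _ "max E E'"]) auto
qed

text \<open>
Pseudo-division by \<open>A\<close> replaces \<open>Q\<close> by a remainder of degree less than that of \<open>A\<close>; the price is a
factor that is exponential in the degree of \<open>Q\<close>.
\<close>
lemma liouville_inequality:
  assumes A: "minimal_annihilator A \<alpha>" and \<alpha>: "norm \<alpha> \<le> 1"
  obtains C E where "1 \<le> C"
    "\<And>Q N. ev Q \<alpha> \<noteq> 0 \<Longrightarrow> degree Q \<le> N \<Longrightarrow> 1 \<le> norm (ev Q \<alpha>) * C ^ (N + 1) * len Q ^ E"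
proof -
  have A0: "A \<noteq> 0" "ev A \<alpha> = 0" using A by (auto simp: minimal_annihilator_def)
  have dA: "0 < degree A" using degree_pos_if_ev_eq_0 A0 .
  obtain c E where c: "0 < c" and
    low: "\<And>R. ev R \<alpha> \<noteq> 0 \<Longrightarrow> degree R < degree A \<Longrightarrow> c \<le> norm (ev R \<alpha>) * len R ^ E"
    using liouville_bounded_degree[OF assms, of "degree A"] by (auto dest: less_imp_le)
  define a where "a = 3 * len A"
  have a: "1 \<le> a" using one_le_len[OF A0(1)] by (simp add: a_def)
  define C where "C = max 1 (1 / c) * a ^ (E + 1)"
  have C: "1 \<le> C"
    unfolding C_def using a by (metis max.cobounded1 mult_mono' mult_1 one_le_power zero_le_one)
  have "1 \<le> norm (ev Q \<alpha>) * C ^ (N + 1) * len Q ^ E" if Q: "ev Q \<alpha> \<noteq> 0" "degree Q \<le> N" for Q N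
  proof -
    define n where "n = N + 1"
    have dQ: "degree Q < degree A + n" using Q(2) by (simp add: n_def)
    obtain S T where ST: "smult (lead_coeff A ^ n) Q = S * A + T" "T = 0 \<or> degree T < degree A"
     "len T \<le> (3 * len A) ^ n * len Q"
      by (rule pseudo_division[OF A0(1) dQ])
    note ST(3)[folded a_def]
    note ST = ST(1,2) this
    have eq: "of_int (lead_coeff A) ^ n * ev Q \<alpha> = ev T \<alpha>"
      using arg_cong[OF ST(1), of "\<lambda>p. ev p \<alpha>"] A0 by (simp add: cpoly_simps)
    then have T0: "ev T \<alpha> \<noteq> 0" using Q A0 by auto
    then have dT: "degree T < degree A" using ST(2) dA by auto
    have "\<bar>real_of_int (lead_coeff A)\<bar> \<le> a"
      using abs_coeff_le_len[of A "degree A"] by (simp add: a_def)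
    then have lc: "\<bar>real_of_int (lead_coeff A)\<bar> ^ n \<le> a ^ n" by (intro power_mono) auto
    have "c \<le> norm (ev T \<alpha>) * len T ^ E" using T0 dT by (rule low)
    also have "\<dots> = \<bar>real_of_int (lead_coeff A)\<bar> ^ n * norm (ev Q \<alpha>) * len T ^ E"
      unfolding eq[symmetric] by (simp add: norm_mult norm_power)
    also have "\<dots> \<le> a ^ n * norm (ev Q \<alpha>) * (a ^ n * len Q) ^ E"
    proof (rule mult_mono)
      show "\<bar>real_of_int (lead_coeff A)\<bar> ^ n * norm (ev Q \<alpha>) \<le> a ^ n * norm (ev Q \<alpha>)"
        using lc by (intro mult_right_mono) auto
      show "len T ^ E \<le> (a ^ n * len Q) ^ E" using ST(3) by (intro power_mono) auto
    qed (use a in auto)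
    also have "\<dots> = norm (ev Q \<alpha>) * (a ^ (E + 1)) ^ n * len Q ^ E"
      by (simp add: power_mult_distrib power_add mult_ac flip: power_mult)
    finally have "1 \<le> (1 / c) * (norm (ev Q \<alpha>) * (a ^ (E + 1)) ^ n * len Q ^ E)"
      using c by (simp add: field_simps)
    also have "\<dots> \<le> max 1 (1 / c) ^ n * (norm (ev Q \<alpha>) * (a ^ (E + 1)) ^ n * len Q ^ E)"
    proof (intro mult_right_mono)
      have "1 / c \<le> max 1 (1 / c) ^ 1" by simp
      also have "\<dots> \<le> max 1 (1 / c) ^ n" by (intro power_increasing) (auto simp: n_def)
      finally show "1 / c \<le> max 1 (1 / c) ^ n" .
    qed (use a in simp)
    also have "\<dots> = norm (ev Q \<alpha>) * C ^ n * len Q ^ E"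
      by (simp add: C_def power_mult_distrib mult_ac)
    finally show ?thesis by (simp add: n_def)
  qed
  then show ?thesis using that C by blast
qed

section \<open>Small annihilating polynomials\<close>

text \<open>
There are more vectors \<open>x\<close> with entries between \<open>0\<close> and the bound than possible values of the \<open>D\<close>
linear forms, so two of them have the same image, and their difference is the solution.
\<close>
lemma siegel_pigeonhole:
  fixes T :: "nat \<Rightarrow> nat \<Rightarrow> int" and X :: nat
  assumes X: "1 \<le> X" and T: "\<And>i j. \<bar>T j i\<bar> \<le> int X"
  shows "\<exists>x. (\<exists>j\<le>D. x j \<noteq> 0) \<and> (\<forall>j\<le>D. \<bar>x j\<bar> \<le> int ((3 * (D + 1) * X) ^ D)) \<and>
     (\<forall>i<D. (\<Sum>j\<le>D. x j * T j i) = 0)"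
proof -
  define B where "B = (3 * (D + 1) * X) ^ D"
  define Z where "Z = (D + 1) * B * X"
  define Dom :: "(nat \<Rightarrow> int) set" where "Dom = {..D} \<rightarrow>\<^sub>E {0..int B}"
  define Cod :: "(nat \<Rightarrow> int) set" where "Cod = {..<D} \<rightarrow>\<^sub>E {- int Z..int Z}"
  define h where "h x = (\<lambda>i\<in>{..<D}. \<Sum>j\<le>D. x j * T j i)" for x :: "nat \<Rightarrow> int"
  have B: "1 \<le> B" unfolding B_def using X by (intro one_le_power) auto
  have "h ` Dom \<subseteq> Cod"
  proof
    fix y assume "y \<in> h ` Dom"
    then obtain x where x: "x \<in> Dom" "y = h x" by blast
    have "\<bar>\<Sum>j\<le>D. x j * T j i\<bar> \<le> int Z" for i
    proof -
      have "\<bar>\<Sum>j\<le>D. x j * T j i\<bar> \<le> (\<Sum>j\<le>D. \<bar>x j * T j i\<bar>)" by (rule sum_abs)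
      also have "\<dots> \<le> (\<Sum>j\<le>D. int B * int X)"
      proof (rule sum_mono)
        fix j assume "j \<in> {..D}"
        then have "x j \<in> {0..int B}" using x(1) by (auto simp: Dom_def)
        then show "\<bar>x j * T j i\<bar> \<le> int B * int X"
          unfolding abs_mult using T[of j i] by (intro mult_mono) auto
      qed
      also have "\<dots> = int Z" by (simp add: Z_def algebra_simps)
      finally show ?thesis .
    qed
    then have "- int Z \<le> (\<Sum>j\<le>D. x j * T j i) \<and> (\<Sum>j\<le>D. x j * T j i) \<le> int Z" for i
      by (simp add: abs_le_iff minus_le_iff)
    then show "y \<in> Cod" unfolding x(2) h_def Cod_def by (intro restrict_PiE_iff[THEN iffD2]) auto
  qed
  moreover have "finite Cod" by (auto simp: Cod_def intro!: finite_PiE)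
  ultimately have "card (h ` Dom) \<le> card Cod" by (intro card_mono)
  also have "card Cod = (2 * Z + 1) ^ D"
  proof -
    have "nat (2 * int Z + 1) = 2 * Z + 1" by linarith
    then show ?thesis by (simp add: Cod_def card_funcsetE)
  qed
  also have "\<dots> \<le> ((3 * (D + 1) * X) * B) ^ D"
  proof (rule power_mono)
    have "1 \<le> Z" using X B by (simp add: Z_def)
    then show "2 * Z + 1 \<le> (3 * (D + 1) * X) * B" by (simp add: Z_def algebra_simps)
  qed simp
  also have "\<dots> = B ^ (D + 1)" by (simp add: power_mult_distrib B_def)
  also have "\<dots> < (B + 1) ^ (D + 1)" by (intro power_strict_mono) auto
  also have "\<dots> = card Dom" by (simp add: Dom_def card_funcsetE nat_add_distrib)
  finally have "\<not> inj_on h Dom" by (rule pigeonhole)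
  then obtain u v where uv: "u \<in> Dom" "v \<in> Dom" "u \<noteq> v" "h u = h v" by (auto simp: inj_on_def)
  show ?thesis
  proof (intro exI[of _ "\<lambda>j. u j - v j"] conjI allI impI)
    have "\<exists>j. u j \<noteq> v j" using uv(3) by auto
    then obtain j where j: "u j \<noteq> v j" ..
    then have "j \<le> D" using uv(1,2) unfolding Dom_def by (metis PiE_arb atMost_iff)
    then show "\<exists>j\<le>D. u j - v j \<noteq> 0" using j by auto
  next
    fix j assume "j \<le> D"
    then have "u j \<in> {0..int B}" "v j \<in> {0..int B}" using uv(1,2) by (auto simp: Dom_def)
    then show "\<bar>u j - v j\<bar> \<le> int ((3 * (D + 1) * X) ^ D)" unfolding B_def[symmetric] by auto
  next
    fix i assume "i < D"
    then show "(\<Sum>j\<le>D. (u j - v j) * T j i) = 0"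
      using fun_cong[OF uv(4), of i] by (simp add: h_def left_diff_distrib sum_subtractf)
  qed
qed

text \<open>
With \<open>D\<close> the degree of \<open>A\<close>, the \<open>D + 1\<close> powers of \<open>G(\<alpha>)\<close>, multiplied by a common power of the leading
coefficient of \<open>A\<close>, are values at \<open>\<alpha>\<close> of integer polynomials of degree less than \<open>D\<close>. A small linear
relation between the \<open>D + 1\<close> coefficient vectors of these polynomials is a small annihilator of
\<open>G(\<alpha>)\<close>.
\<close>
lemma small_annihilator:
  assumes A: "A \<noteq> 0" "ev A \<alpha> = 0"
  obtains C E :: nat where "1 \<le> C"
    "\<And>G N Y. degree G \<le> N \<Longrightarrow> len G \<le> real Y \<Longrightarrow> 1 \<le> Y \<Longrightarrow>
       \<exists>B. B \<noteq> 0 \<and> degree B \<le> degree A \<and> ev B (ev G \<alpha>) = 0 \<and> len B \<le> real (C ^ (N + 1) * Y ^ E)"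
proof -
  define D where "D = degree A"
  define K where "K = nat \<lceil>3 * len A\<rceil>"
  have K: "3 * len A \<le> real K" by (simp add: K_def)
  then have K1: "1 \<le> K" using one_le_len[OF A(1)] by linarith
  define c0 where "c0 = (D + 1) * (3 * (D + 1)) ^ D"
  have c0: "1 \<le> c0" by (simp add: c0_def Suc_le_eq)
  define C where "C = c0 * K ^ ((D + 1) * D)"
  have C: "1 \<le> C" unfolding C_def using c0 K1 by simp
  have "\<exists>B. B \<noteq> 0 \<and> degree B \<le> degree A \<and> ev B (ev G \<alpha>) = 0 \<and> len B \<le> real (C ^ (N + 1) * Y ^ (D * D))"
    if G: "degree G \<le> N" "len G \<le> real Y" "1 \<le> Y" for G N and Y :: nat
  proof -
    \<comment> \<open>One exponent serves all powers \<open>G ^ j\<close>, so that the same factor \<open>a ^ n\<close> occurs in each relation.\<close>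
    define n where "n = D * N + 1"
    define a where "a = lead_coeff A"
    have a: "a \<noteq> 0" using A by (simp add: a_def)
    define X where "X = K ^ n * Y ^ D"
    have X: "1 \<le> X" using K1 G(3) by (simp add: X_def)
    have "\<exists>S T. smult (a ^ n) (G ^ j) = S * A + T \<and> (\<forall>i\<ge>D. coeff T i = 0) \<and> len T \<le> real X"
      if j: "j \<le> D" for j
    proof -
      have "degree (G ^ j) \<le> degree G * j" by (rule degree_power_le)
      also have "\<dots> \<le> N * D" using G j by (intro mult_mono) auto
      finally have deg: "degree (G ^ j) < degree A + n" by (simp add: n_def mult.commute)
      obtain S T where ST: "smult (lead_coeff A ^ n) (G ^ j) = S * A + T"
         "T = 0 \<or> degree T < degree A" "\<forall>i\<ge>degree A. coeff T i = 0"
         "len S \<le> (3 * len A) ^ n * len (G ^ j)" "len T \<le> (3 * len A) ^ n * len (G ^ j)"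
        by (rule pseudo_division[OF A(1) deg])
      have "len (G ^ j) \<le> len G ^ j" by (simp add: cpoly_power poly_length_power)
      also have "\<dots> \<le> real Y ^ j" using G by (intro power_mono) auto
      also have "\<dots> \<le> real Y ^ D" using G j by (intro power_increasing) auto
      finally have "(3 * len A) ^ n * len (G ^ j) \<le> real K ^ n * real Y ^ D"
        using K by (intro mult_mono power_mono) auto
      then have "len T \<le> real X" using ST(5) by (simp add: X_def)
      then show ?thesis using ST(1,3) unfolding a_def D_def by blast
    qed
    then obtain S T where ST:
      "\<And>j. j \<le> D \<Longrightarrow> smult (a ^ n) (G ^ j) = S j * A + T j"
      "\<And>i j. j \<le> D \<Longrightarrow> i \<ge> D \<Longrightarrow> coeff (T j) i = 0"
      "\<And>j. j \<le> D \<Longrightarrow> len (T j) \<le> real X"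
      by metis
    \<comment> \<open>The pigeonhole lemma bounds all entries, so the rows beyond D are filled with zeros.\<close>
    define T' where "T' j i = (if j \<le> D then coeff (T j) i else 0)" for i j
    have T'X: "\<bar>T' j i\<bar> \<le> int X" for i j
      using abs_coeff_le_len[of "T j" i] ST(3)[of j] by (auto simp: T'_def)
    from siegel_pigeonhole[of X T' D, OF X T'X] obtain x where x: "\<exists>j\<le>D. x j \<noteq> 0"
      "\<forall>j\<le>D. \<bar>x j\<bar> \<le> int ((3 * (D + 1) * X) ^ D)"
      "\<forall>i<D. (\<Sum>j\<le>D. x j * T' j i) = 0" by blast
    define B where "B = (\<Sum>j\<le>D. monom (x j) j)"
    have coeff_B: "coeff B j = (if j \<le> D then x j else 0)" for j
      by (auto simp: B_def coeff_sum)
    have T0: "(\<Sum>j\<le>D. smult (x j) (T j)) = 0"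
    proof (rule poly_eqI)
      fix i
      have "(\<Sum>j\<le>D. x j * coeff (T j) i) = (\<Sum>j\<le>D. x j * T' j i)" by (simp add: T'_def)
      then show "coeff (\<Sum>j\<le>D. smult (x j) (T j)) i = coeff 0 i"
        using x(3) ST(2)[of _ i] by (cases "i < D") (auto simp: coeff_sum)
    qed
    have evT: "of_int a ^ n * ev G \<alpha> ^ j = ev (T j) \<alpha>" if "j \<le> D" for j
      using arg_cong[OF ST(1)[OF that], of "\<lambda>p. ev p \<alpha>"] A by (simp add: cpoly_simps)
    have "of_int a ^ n * ev B (ev G \<alpha>) = (\<Sum>j\<le>D. of_int (x j) * (of_int a ^ n * ev G \<alpha> ^ j))"
      by (simp add: B_def cpoly_simps poly_sum poly_monom sum_distrib_left mult_ac)
    also have "\<dots> = (\<Sum>j\<le>D. of_int (x j) * ev (T j) \<alpha>)" by (intro sum.cong) (auto simp: evT)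
    also have "\<dots> = ev (\<Sum>j\<le>D. smult (x j) (T j)) \<alpha>" by (simp add: cpoly_simps poly_sum)
    also have "\<dots> = 0" by (simp add: T0)
    finally have ev: "ev B (ev G \<alpha>) = 0" using a by simp
    obtain j where "j \<le> D" "x j \<noteq> 0" using x(1) by blast
    then have "coeff B j \<noteq> 0" by (simp add: coeff_B)
    then have B0: "B \<noteq> 0" by auto
    have degB: "degree B \<le> D" by (rule degree_le) (simp add: coeff_B)
    have "len B = (\<Sum>j\<le>D. \<bar>real_of_int (coeff B j)\<bar>)" using degB by (rule len_eq_sum)
    also have "\<dots> \<le> (\<Sum>j\<le>D. real ((3 * (D + 1) * X) ^ D))"
    proof (rule sum_mono)
      fix j assume "j \<in> {..D}"
      then have "\<bar>coeff B j\<bar> \<le> int ((3 * (D + 1) * X) ^ D)" using x(2) unfolding coeff_B by auto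
      then show "\<bar>real_of_int (coeff B j)\<bar> \<le> real ((3 * (D + 1) * X) ^ D)"
        by (metis of_int_abs of_int_le_iff of_int_of_nat_eq)
    qed
    also have "\<dots> = real ((D + 1) * (3 * (D + 1) * X) ^ D)" by (simp add: distrib_right)
    also have "\<dots> \<le> real (C ^ (N + 1) * Y ^ (D * D))"
    proof (rule of_nat_mono)
      have "(D + 1) * (3 * (D + 1) * X) ^ D = c0 * K ^ (n * D) * Y ^ (D * D)"
        unfolding c0_def X_def power_mult_distrib power_mult by (simp only: mult_ac)
      also have "\<dots> \<le> c0 ^ (N + 1) * K ^ ((D + 1) * D * (N + 1)) * Y ^ (D * D)"
      proof (intro mult_mono)
        show "c0 \<le> c0 ^ (N + 1)" using power_increasing[of 1 "N + 1" c0] c0 by simp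
        have "n * D \<le> (D + 1) * (N + 1) * D" by (intro mult_right_mono) (auto simp: n_def)
        then show "K ^ (n * D) \<le> K ^ ((D + 1) * D * (N + 1))"
          using K1 by (intro power_increasing) (auto simp: algebra_simps)
      qed auto
      also have "\<dots> = C ^ (N + 1) * Y ^ (D * D)"
        unfolding C_def power_mult_distrib power_mult ..
      finally show "(D + 1) * (3 * (D + 1) * X) ^ D \<le> C ^ (N + 1) * Y ^ (D * D)" .
    qed
    finally show ?thesis using B0 degB ev unfolding D_def by blast
  qed
  then show ?thesis using that C by blast
qed

section \<open>Lengths of factors\<close>

text \<open>
Let \<open>n\<close> be the degree of \<open>N\<close>. If \<open>\<bar>z\<bar> > 1\<close>, the leading term is at least
\<open>\<bar>z\<bar>^n\<close>, whereas the other terms add up to at most \<open>len N * \<bar>z\<bar>^(n-1)\<close>.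
\<close>
lemma root_bound:
  assumes "N \<noteq> 0" "ev N z = 0"
  shows "norm z \<le> len N"
proof (cases "norm z \<le> 1")
  case True
  then show ?thesis using one_le_len[OF assms(1)] by linarith
next
  case False
  have "0 < degree N" using degree_pos_if_ev_eq_0 assms .
  then obtain k where k: "degree N = Suc k" by (cases "degree N") auto
  define c where "c i = (of_int (coeff N i) :: complex)" for i
  have lc: "1 \<le> norm (c (Suc k))"
  proof -
    have "lead_coeff N \<noteq> 0" using assms by simp
    then have "1 \<le> \<bar>real_of_int (lead_coeff N)\<bar>" by linarith
    then show ?thesis by (simp add: c_def k)
  qed
  have "(\<Sum>i\<le>Suc k. c i * z ^ i) = 0"
    using assms(2) by (simp add: poly_altdef degree_cpoly k coeff_map_poly c_def del: sum.atMost_Suc)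
  then have eq: "c (Suc k) * z ^ Suc k = - (\<Sum>i\<le>k. c i * z ^ i)" by (simp add: eq_neg_iff_add_eq_0 add.commute)
  have "norm z * norm z ^ k \<le> norm (c (Suc k)) * norm (z ^ Suc k)"
    using mult_right_mono[OF lc, of "norm z ^ Suc k"] by (simp add: norm_power norm_mult)
  also have "\<dots> = norm (\<Sum>i\<le>k. c i * z ^ i)"
    using arg_cong[OF eq, of norm] by (simp only: norm_mult norm_minus_cancel)
  also have "\<dots> \<le> (\<Sum>i\<le>k. norm (c i) * norm z ^ k)"
  proof (rule sum_norm_le)
    fix i assume "i \<in> {..k}"
    then show "norm (c i * z ^ i) \<le> norm (c i) * norm z ^ k"
      using False by (simp add: norm_mult norm_power power_increasing mult_left_mono)
  qed
  also have "\<dots> = (\<Sum>i\<le>k. norm (c i)) * norm z ^ k" by (simp add: sum_distrib_right)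
  also have "\<dots> \<le> len N * norm z ^ k"
  proof (rule mult_right_mono)
    have "len N = (\<Sum>i\<le>Suc k. \<bar>real_of_int (coeff N i)\<bar>)" by (rule len_eq_sum) (simp add: k)
    then show "(\<Sum>i\<le>k. norm (c i)) \<le> len N" by (simp add: c_def)
  qed simp
  finally have "norm z * norm z ^ k \<le> len N * norm z ^ k" .
  moreover have "0 < norm z ^ k" using False by (intro zero_less_power) linarith
  ultimately show ?thesis by (simp only: mult_le_cancel_right_pos)
qed

text \<open>
The roots of \<open>M\<close> are roots of \<open>N\<close> and thus bounded by \<open>len N\<close>, and the leading coefficient of \<open>M\<close>
divides that of \<open>N\<close>. The length of \<open>M\<close> is at most the leading coefficient times the
product of the lengths of the linear factors.
This is far weaker than the bounds of Gelfond and Mignotte, but it is polynomial in \<open>len N\<close> when the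
degree is bounded.
\<close>
lemma len_factor_le:
  assumes "N \<noteq> 0" "M dvd N"
  shows "len M \<le> (1 + len N) ^ (degree N + 1)"
proof -
  obtain S where S: "N = M * S" using assms(2) by blast
  then have M0: "M \<noteq> 0" "S \<noteq> 0" using assms by auto
  have deg: "degree M \<le> degree N" using S M0 by (simp add: degree_mult_eq)
  obtain root where root:
    "smult (lead_coeff (cpoly M)) (\<Prod>i<degree (cpoly M). [:-root i, 1:]) = cpoly M"
    by (rule complex_poly_decompose')
  have "norm (root i) \<le> len N" if "i < degree M" for i
  proof (rule root_bound[OF assms(1)])
    have "poly (cpoly M) (root i) = 0"
      unfolding arg_cong[OF root[symmetric], of "\<lambda>p. poly p (root i)"]
      using that by (auto simp: poly_prod degree_cpoly)
    then show "ev N (root i) = 0" by (simp add: S cpoly_mult)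
  qed
  then have "poly_length (\<Prod>i<degree M. [:-root i, 1:]) \<le> (1 + len N) ^ card {..<degree M}"
  proof -
    assume r: "\<And>i. i < degree M \<Longrightarrow> norm (root i) \<le> len N"
    have "poly_length (\<Prod>i\<in>I. [:-root i, 1:]) \<le> (1 + len N) ^ card I"
      if "finite I" "I \<subseteq> {..<degree M}" for I
      using that
    proof (induction I)
      case (insert i I)
      have "poly_length (\<Prod>i\<in>insert i I. [:-root i, 1:])
         \<le> poly_length [:-root i, 1:] * poly_length (\<Prod>i\<in>I. [:-root i, 1:])"
        unfolding prod.insert[OF insert.hyps(1,2)] by (rule poly_length_mult)
      also have "\<dots> \<le> (1 + len N) * (1 + len N) ^ card I"
        using insert r[of i] by (intro mult_mono) auto
      finally show ?case using insert.hyps by simp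
    qed simp
    then show ?thesis by blast
  qed
  then have *: "poly_length (\<Prod>i<degree M. [:-root i, 1:]) \<le> (1 + len N) ^ degree N"
    using power_increasing[OF deg, of "1 + len N"] by simp
  have "lead_coeff N = lead_coeff M * lead_coeff S" by (simp add: S lead_coeff_mult)
  moreover have "lead_coeff S \<noteq> 0" using M0 by simp
  then have "1 \<le> \<bar>lead_coeff S\<bar>" by linarith
  ultimately have "\<bar>lead_coeff M\<bar> \<le> \<bar>lead_coeff N\<bar>"
    by (simp add: abs_mult mult_le_cancel_left1)
  then have "\<bar>real_of_int (lead_coeff M)\<bar> \<le> \<bar>real_of_int (lead_coeff N)\<bar>" by linarith
  also have "\<dots> \<le> 1 + len N" using abs_coeff_le_len[of N "degree N"] by linarith
  finally have lc: "\<bar>real_of_int (lead_coeff M)\<bar> \<le> 1 + len N" .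
  have "len M = \<bar>real_of_int (lead_coeff M)\<bar> * poly_length (\<Prod>i<degree M. [:-root i, 1:])"
    using arg_cong[OF root, of poly_length] by (simp add: degree_cpoly coeff_map_poly)
  also have "\<dots> \<le> (1 + len N) * (1 + len N) ^ degree N"
    using lc * by (intro mult_mono) auto
  finally show ?thesis by simp
qed

section \<open>The two notions of degree\<close>

lemma irreducible_factor_at_root:
  fixes N :: "int poly"
  assumes "N \<noteq> 0" "ev N x = 0"
  shows "\<exists>M. irreducible M \<and> ev M x = 0 \<and> M dvd N"
  using assms
proof (induction N rule: prime_divisors_induct)
  case zero
  then show ?case by simp
next
  case (unit N)
  then obtain K where "N * K = 1" by (metis dvdE)
  then have "ev N x * ev K x = 1" by (metis cpoly_mult map_poly_1' of_int_1 poly_1 poly_mult)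
  then show ?case using unit by simp
next
  case (factor p N)
  show ?case
  proof (cases "ev p x = 0")
    case True
    then show ?thesis using factor
      by (intro exI[of _ p]) (auto simp: prime_elem_imp_irreducible)
  next
    case False
    then have "ev N x = 0" using factor.prems(2) by (simp add: cpoly_mult)
    moreover have "N \<noteq> 0" using factor.prems(1) by auto
    ultimately show ?thesis using factor.IH by (meson dvd_mult)
  qed
qed

text \<open>
Let \<open>A\<close> be an annihilator of least degree. By pseudo-division a nonzero constant multiple
of \<open>M\<close> equals \<open>S * A\<close> for some \<open>S\<close>. As \<open>M\<close> is a prime element of the integer polynomials
and \<open>S\<close> has smaller degree than \<open>M\<close>, it divides \<open>A\<close>.
\<close>
lemma int_min_poly_minimal:
  assumes "is_int_min_poly M x"
  shows "minimal_annihilator M x"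
proof -
  have M: "irreducible M" "ev M x = 0" using assms by (auto simp: is_int_min_poly_def)
  then have M0: "M \<noteq> 0" by auto
  obtain A where A: "minimal_annihilator A x" using minimal_annihilator_exists M0 M(2) by blast
  have A0: "A \<noteq> 0" "ev A x = 0" and
    Amin: "\<And>B. B \<noteq> 0 \<Longrightarrow> ev B x = 0 \<Longrightarrow> degree A \<le> degree B"
    using A by (auto simp: minimal_annihilator_def)
  have deg: "degree M < degree A + (degree M + 1)" by simp
  obtain S T where ST: "smult (lead_coeff A ^ (degree M + 1)) M = S * A + T"
      "T = 0 \<or> degree T < degree A"
    by (rule pseudo_division[OF A0(1) deg])
  have "ev T x = 0"
    using arg_cong[OF ST(1), of "\<lambda>p. ev p x"] A0 M by (simp add: cpoly_simps)
  then have "T = 0" using Amin[of T] ST(2) by linarith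
  then have eq: "smult (lead_coeff A ^ (degree M + 1)) M = S * A" using ST(1) by simp
  then have S0: "S \<noteq> 0" using A0 M0 by auto
  have dA: "0 < degree A" using degree_pos_if_ev_eq_0 A0 .
  have degM: "degree M = degree S + degree A"
    using arg_cong[OF eq, of degree] S0 A0 by (simp add: degree_mult_eq)
  have "M dvd S * A" using eq by (metis dvd_refl dvd_smult)
  then have "M dvd S \<or> M dvd A"
    using M(1) by (simp add: irreducible_imp_prime_elem prime_elem_dvd_mult_iff)
  moreover have "\<not> M dvd S" using degM dA dvd_imp_degree_le[of M S] S0 by auto
  ultimately have "M dvd A" by blast
  then have "degree M \<le> degree A" using A0 by (intro dvd_imp_degree_le)
  then show ?thesis using M0 M(2) Amin unfolding minimal_annihilator_def
    by (meson order_trans)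
qed

lemma clear_denominators:
  fixes p :: "rat poly"
  shows "\<exists>c q. c \<noteq> 0 \<and> map_poly of_int q = smult (of_int c) p"
proof (induction p)
  case 0
  show ?case by (intro exI[of _ 1] exI[of _ 0]) simp
next
  case (pCons a p)
  then obtain c q where cq: "c \<noteq> 0" "map_poly of_int q = smult (of_int c) p" by blast
  obtain u v :: int where uv: "a = of_int u / of_int v" "v \<noteq> 0"
    by (metis Rat_cases Fract_of_int_quotient less_irrefl)
  have "map_poly rat_of_int (pCons (c * u) (smult v q)) = smult (of_int (c * v)) (pCons a p)"
    using cq uv by (simp add: map_poly_pCons map_poly_smult mult.commute)
  then show ?case using cq(1) uv(2) by (intro exI[of _ "c * v"] exI[of _ "pCons (c * u) (smult v q)"]) simp
qed

lemma map_poly_of_rat_mult: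
  "map_poly of_rat (p * q) = (map_poly of_rat p * map_poly of_rat q :: complex poly)"
proof (induction p)
  case (pCons a p)
  have "map_poly of_rat (r + s) = (map_poly of_rat r + map_poly of_rat s :: complex poly)" for r s
    by (rule poly_eqI) (simp add: coeff_map_poly of_rat_add)
  then show ?case using pCons by (simp add: map_poly_pCons map_poly_smult of_rat_mult)
qed simp

text \<open>
An annihilator \<open>\<mu>\<close> of least degree divides \<open>p\<close> by Euclidean division, and \<open>p\<close> is irreducible, so the
two have the same degree.
\<close>
lemma rat_min_poly_minimal:
  assumes p: "irreducible p" "poly (map_poly of_rat p) x = (0::complex)"
    and q: "q \<noteq> 0" "poly (map_poly of_rat q) x = 0"
  shows "degree p \<le> degree q"
proof -
  obtain \<mu> where \<mu>: "\<mu> \<noteq> 0 \<and> poly (map_poly of_rat \<mu>) x = 0" and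
    min: "\<forall>r. r \<noteq> 0 \<and> poly (map_poly of_rat r) x = 0 \<longrightarrow> degree \<mu> \<le> degree r"
    using ex_has_least_nat[of "\<lambda>r. r \<noteq> 0 \<and> poly (map_poly of_rat r) x = 0" q degree] q by blast
  define r where "r = p mod \<mu>"
  have "p = (p div \<mu>) * \<mu> + r" by (simp add: r_def)
  moreover have "map_poly of_rat (a + b) = (map_poly of_rat a + map_poly of_rat b :: complex poly)" for a b
    by (rule poly_eqI) (simp add: coeff_map_poly of_rat_add)
  ultimately have "poly (map_poly of_rat p) x
      = poly (map_poly of_rat (p div \<mu>)) x * poly (map_poly of_rat \<mu>) x + poly (map_poly of_rat r) x"
    by (metis map_poly_of_rat_mult poly_add poly_mult)
  then have "poly (map_poly of_rat r) x = 0" using p \<mu> by simp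
  then have "r = 0" using min degree_mod_less[of \<mu> p] \<mu> unfolding r_def by fastforce
  then have eq: "p = \<mu> * (p div \<mu>)" by (simp add: r_def mod_0_imp_dvd)
  have "\<not> is_unit \<mu>"
  proof
    assume "is_unit \<mu>"
    then obtain a where "\<mu> = [:a:]" by (auto simp: is_unit_poly_iff)
    then show False using \<mu> by (simp add: map_poly_pCons)
  qed
  then have "is_unit (p div \<mu>)" using irreducibleD[OF p(1) eq] by blast
  then have "degree (p div \<mu>) = 0" by (auto simp: is_unit_poly_iff)
  moreover have "degree p = degree \<mu> + degree (p div \<mu>)"
    using eq p(1) by (metis degree_mult_eq mult_zero_left mult_zero_right not_irreducible_zero)
  ultimately show ?thesis using min q by auto
qed

lemma degree_of_rat_poly: "degree (map_poly of_rat p :: complex poly) = degree p"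
  by (rule degree_map_poly) auto

lemma cpoly_via_rat: "cpoly p = map_poly of_rat (map_poly of_int p)"
  by (rule poly_eqI) (simp add: coeff_map_poly)

lemma clear_denominators_annihilator:
  assumes "p \<noteq> 0" "poly (map_poly of_rat p) x = (0::complex)"
  obtains q where "q \<noteq> 0" "ev q x = 0" "degree q = degree p"
proof -
  obtain c q where cq: "c \<noteq> 0" "map_poly of_int q = smult (of_int c) p"
    using clear_denominators by blast
  have *: "cpoly q = smult (of_int c) (map_poly of_rat p)"
    unfolding cpoly_via_rat cq(2) by (rule poly_eqI) (simp add: coeff_map_poly of_rat_mult)
  have "map_poly of_rat p \<noteq> (0 :: complex poly)" using assms(1) by (simp add: map_poly_eq_0_iff)
  then have "cpoly q \<noteq> 0" unfolding * using cq(1) by simp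
  then have "q \<noteq> 0" by auto
  moreover have "ev q x = 0" unfolding * using assms(2) by simp
  moreover have "degree q = degree p"
    using arg_cong[OF *, of degree] cq(1) by (simp add: degree_cpoly degree_of_rat_poly)
  ultimately show ?thesis using that by blast
qed

text \<open>
Clearing denominators turns rational annihilators into integer ones of the same degree, so the least
degree is the same for both kinds of coefficients.
\<close>
lemma algebraic_of_degree_iff:
  "algebraic_of_degree x d \<longleftrightarrow> (\<exists>A. minimal_annihilator A x \<and> degree A = d)"
proof
  assume "algebraic_of_degree x d"
  then obtain p :: "rat poly" where p: "irreducible p" "poly (map_poly of_rat p) x = 0" "degree p = d"
    by (auto simp: algebraic_of_degree_def)
  then have "p \<noteq> 0" by auto
  then obtain q where q: "q \<noteq> 0" "ev q x = 0" "degree q = d"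
    using clear_denominators_annihilator p by metis
  have "degree q \<le> degree B" if "B \<noteq> 0" "ev B x = 0" for B
    using rat_min_poly_minimal[OF p(1,2), of "map_poly of_int B"] that p(3) q(3)
    by (simp add: cpoly_via_rat map_poly_eq_0_iff degree_map_poly)
  then show "\<exists>A. minimal_annihilator A x \<and> degree A = d"
    using q unfolding minimal_annihilator_def by blast
next
  assume "\<exists>A. minimal_annihilator A x \<and> degree A = d"
  then obtain A where A: "A \<noteq> 0" "ev A x = 0" "degree A = d"
    and Amin: "\<And>B. B \<noteq> 0 \<Longrightarrow> ev B x = 0 \<Longrightarrow> d \<le> degree B"
    by (auto simp: minimal_annihilator_def)
  define p :: "rat poly" where "p = map_poly of_int A"
  have p: "p \<noteq> 0" "poly (map_poly of_rat p) x = 0" "degree p = d"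
    using A by (simp_all add: p_def cpoly_via_rat[symmetric] map_poly_eq_0_iff degree_map_poly)
  have d: "0 < d" using degree_pos_if_ev_eq_0[OF A(1,2)] A(3) by simp
  have min: "d \<le> degree r" if "r \<noteq> 0" "poly (map_poly of_rat r) x = 0" for r
    using clear_denominators_annihilator[OF that] Amin by metis
  have "irreducible p"
  proof (rule irreducibleI)
    show "p \<noteq> 0" by (rule p)
    show "\<not> is_unit p" using p(3) d by (auto simp: is_unit_poly_iff)
    fix a b assume ab: "p = a * b"
    then have ab0: "a \<noteq> 0" "b \<noteq> 0" using p by auto
    then have deg: "d = degree a + degree b" using p(3) ab by (simp add: degree_mult_eq)
    have "poly (map_poly of_rat a) x = 0 \<or> poly (map_poly of_rat b) x = 0"
      using p(2) by (simp add: ab map_poly_of_rat_mult)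
    then have "degree b = 0 \<or> degree a = 0" using min[of a] min[of b] ab0 deg by auto
    then show "is_unit a \<or> is_unit b" using ab0 by (auto simp: is_unit_iff_degree)
  qed
  then show "algebraic_of_degree x d" using p by (auto simp: algebraic_of_degree_def)
qed

section \<open>Numbers with very good approximations from a fixed number field\<close>

text \<open>
The data of the theorem that matter for the Diophantine argument. The number \<open>\<gamma>\<close> is approximated by
values of integer polynomials at \<open>\<alpha>\<close>, where \<open>s n\<close> governs the complexity of the \<open>n\<close>-th approximation
and \<open>t n\<close> its quality.
\<close>
locale field_approximations =
  fixes A :: "int poly" and \<alpha> \<gamma> :: complex and G :: "nat \<Rightarrow> int poly" and s t :: "nat \<Rightarrow> nat"
    and L b :: nat and c q :: real
  assumes A: "minimal_annihilator A \<alpha>" and \<alpha>: "norm \<alpha> \<le> 1"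
    and L: "1 \<le> L" and c: "0 < c" and q: "0 < q" "q < 1"
    and degree_G: "\<And>n. 1 \<le> n \<Longrightarrow> degree (G n) \<le> s n"
    and len_G: "\<And>n. 1 \<le> n \<Longrightarrow> len (G n) \<le> real (L ^ (s n + 1))"
    and close: "\<And>n. 1 \<le> n \<Longrightarrow> norm (\<gamma> - ev (G n) \<alpha>) \<le> c * q ^ t n"
    and s_le_t: "\<And>n. 1 \<le> n \<Longrightarrow> s n < t n"
    and t_le_s: "\<And>n. 1 \<le> n \<Longrightarrow> t n \<le> s (n + 1)"
    and s_le_bt: "\<And>n. 1 \<le> n \<Longrightarrow> s (n + 1) \<le> b * t n"
    and ratio: "filterlim (\<lambda>n. real (t n) / real (s n)) at_top sequentially"
begin

definition \<beta> :: "nat \<Rightarrow> complex" where "\<beta> n = ev (G n) \<alpha>"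

lemma le_s: "1 \<le> n \<Longrightarrow> n \<le> s n + 1"
proof (induction n rule: dec_induct)
  case (step n)
  then show ?case using s_le_t[of n] t_le_s[of n] by simp
qed simp

text \<open>
This is where the growth of \<open>t n / s n\<close> is used: a power with exponent \<open>t n\<close> of a number below \<open>1\<close>
absorbs every exponential in \<open>s n\<close>.
\<close>
lemma decay:
  assumes p: "0 < p" "p < 1" and X: "1 \<le> X" and K: "0 \<le> K"
  shows "\<exists>n0\<ge>1. \<forall>n\<ge>n0. K * p ^ t n * X ^ (s n + 1) < (1 :: real)"
proof -
  have "(\<lambda>k. p ^ k) \<longlonglongrightarrow> 0" using p by (intro LIMSEQ_realpow_zero) auto
  then have "\<forall>\<^sub>F k in sequentially. p ^ k < 1 / (2 * X ^ 2)"
    using X by (intro order_tendstoD) auto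
  then obtain k where k: "p ^ k < 1 / (2 * X ^ 2)" by (auto simp: eventually_sequentially)
  have half: "p ^ k * X ^ 2 \<le> 1 / 2" using k X by (simp add: field_simps)
  have "(\<lambda>m. K * (1 / 2 :: real) ^ m) \<longlonglongrightarrow> K * 0"
    by (intro tendsto_intros LIMSEQ_realpow_zero) auto
  then have "\<forall>\<^sub>F m in sequentially. K * (1 / 2 :: real) ^ m < 1" by (intro order_tendstoD) auto
  then obtain m0 where m0: "\<And>m. m \<ge> m0 \<Longrightarrow> K * (1 / 2 :: real) ^ m < 1"
    by (auto simp: eventually_sequentially)
  \<comment> \<open>Eventually t n is at least k * s n, so that the expression is at most K * (1/2) ^ s n.\<close>
  have "\<forall>\<^sub>F n in sequentially. real k \<le> real (t n) / real (s n)"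
    using ratio by (simp add: filterlim_at_top)
  then obtain n1 where n1: "\<And>n. n \<ge> n1 \<Longrightarrow> real k \<le> real (t n) / real (s n)"
    by (auto simp: eventually_sequentially)
  have "K * p ^ t n * X ^ (s n + 1) < 1" if n: "n \<ge> Max {n1, m0 + 1, 2}" for n
  proof -
    have s: "s n \<ge> m0" "s n \<ge> 1" using le_s[of n] n by auto
    have "real k * real (s n) \<le> real (t n)" using n1[of n] n s by (simp add: field_simps)
    then have kt: "k * s n \<le> t n" by (metis of_nat_le_iff of_nat_mult)
    have "p ^ t n * X ^ (s n + 1) \<le> p ^ (k * s n) * X ^ (2 * s n)"
      using kt s p X by (intro mult_mono power_decreasing power_increasing) auto
    also have "\<dots> = (p ^ k * X ^ 2) ^ s n" by (simp add: power_mult power_mult_distrib)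
    also have "\<dots> \<le> (1 / 2) ^ s n" using half p X by (intro power_mono) auto
    finally have "K * (p ^ t n * X ^ (s n + 1)) \<le> K * (1 / 2) ^ s n"
      using K by (rule mult_left_mono)
    also have "\<dots> < 1" using s by (intro m0)
    finally show ?thesis by (simp add: mult.assoc)
  qed
  then show ?thesis by (intro exI[of _ "Max {n1, m0 + 1, 2}"]) auto
qed

lemma \<beta>_close: "1 \<le> n \<Longrightarrow> norm (\<gamma> - \<beta> n) \<le> c * q ^ t n"
  unfolding \<beta>_def by (rule close)

lemma \<beta>_tendsto: "\<beta> \<longlonglongrightarrow> \<gamma>"
proof -
  have "filterlim t at_top sequentially"
    unfolding filterlim_at_top
  proof
    fix Z
    show "\<forall>\<^sub>F n in sequentially. Z \<le> t n"
      using eventually_ge_at_top[of "max 1 Z"]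
    proof eventually_elim
      case (elim n)
      then show ?case using le_s[of n] s_le_t[of n] by simp
    qed
  qed
  then have "(\<lambda>n. c * q ^ t n) \<longlonglongrightarrow> c * 0"
    using q by (intro tendsto_mult tendsto_const filterlim_compose[OF LIMSEQ_realpow_zero]) auto
  then have "(\<lambda>n. norm (\<gamma> - \<beta> n)) \<longlonglongrightarrow> 0"
    by (intro tendsto_sandwich[of "\<lambda>_. 0" "\<lambda>n. norm (\<gamma> - \<beta> n)" sequentially "\<lambda>n. c * q ^ t n"])
       (auto intro!: \<beta>_close eventually_sequentiallyI[of 1])
  then have "(\<lambda>n. \<beta> n - \<gamma>) \<longlonglongrightarrow> 0"
    by (subst tendsto_norm_zero_iff[symmetric]) (simp add: norm_minus_commute[of _ \<gamma>])
  then show ?thesis by (rule LIM_zero_cancel)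
qed

text \<open>
The minimal polynomial is found among the irreducible factors of a small annihilator.
\<close>
lemma \<beta>_min_poly:
  obtains H :: nat where "1 \<le> H"
    "\<And>n. 1 \<le> n \<Longrightarrow> \<exists>M. is_int_min_poly M (\<beta> n) \<and> degree M \<le> degree A \<and> len M \<le> real H ^ (s n + 1)"
proof -
  obtain C E :: nat where CE: "1 \<le> C"
    "\<And>G N Y. degree G \<le> N \<Longrightarrow> len G \<le> real Y \<Longrightarrow> 1 \<le> Y \<Longrightarrow>
       \<exists>B. B \<noteq> 0 \<and> degree B \<le> degree A \<and> ev B (ev G \<alpha>) = 0 \<and> len B \<le> real (C ^ (N + 1) * Y ^ E)"
    using small_annihilator[of A \<alpha>] A unfolding minimal_annihilator_def by metis
  define D where "D = degree A"
  define H1 where "H1 = C * L ^ E"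
  define H where "H = (2 * H1) ^ (D + 1)"
  have H1: "1 \<le> H1" using CE(1) L by (simp add: H1_def)
  have H: "1 \<le> H" unfolding H_def using H1 by (intro one_le_power) auto
  have "\<exists>M. is_int_min_poly M (\<beta> n) \<and> degree M \<le> degree A \<and> len M \<le> real H ^ (s n + 1)"
    if n: "1 \<le> n" for n
  proof -
    define k where "k = s n + 1"
    obtain B where B: "B \<noteq> 0" "degree B \<le> D" "ev B (\<beta> n) = 0"
      "len B \<le> real (C ^ (s n + 1) * (L ^ (s n + 1)) ^ E)"
      using CE(2)[OF degree_G[OF n] len_G[OF n]] L unfolding \<beta>_def D_def by auto
    have lenB: "len B \<le> real H1 ^ k"
      using B(4) unfolding H1_def k_def[symmetric] by (simp add: power_mult_distrib flip: power_mult) (simp add: mult.commute)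
    obtain M where M: "irreducible M" "ev M (\<beta> n) = 0" "M dvd B"
      using irreducible_factor_at_root[OF B(1,3)] by blast
    have "degree M \<le> D" using dvd_imp_degree_le[OF M(3) B(1)] B(2) by simp
    moreover have "len M \<le> real H ^ k"
    proof -
      have one: "1 \<le> real H1 ^ k" using H1 by (intro one_le_power) simp
      have "len M \<le> (1 + len B) ^ (degree B + 1)" using len_factor_le[OF B(1) M(3)] .
      also have "\<dots> \<le> (1 + len B) ^ (D + 1)" using B(2) by (intro power_increasing) auto
      also have "\<dots> \<le> (2 * real H1 ^ k) ^ (D + 1)" using lenB one by (intro power_mono) auto
      also have "\<dots> \<le> (2 ^ k * real H1 ^ k) ^ (D + 1)"
        using power_increasing[of 1 k "2::real"] by (intro power_mono mult_right_mono) (auto simp: k_def)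
      also have "\<dots> = real H ^ k"
        by (simp add: H_def power_mult_distrib mult_ac flip: power_mult power_Suc)
      finally show ?thesis .
    qed
    ultimately show ?thesis using M unfolding is_int_min_poly_def D_def k_def by blast
  qed
  then show ?thesis using that H by blast
qed

text \<open>
Liouville's inequality applies to the composition of \<open>M\<close> with \<open>G n\<close>, whose value at \<open>\<alpha>\<close> is
\<open>M(\<beta> n)\<close>.
\<close>
lemma \<beta>_lower_bound:
  obtains W :: real and E where "1 \<le> W"
    "\<And>n M. 1 \<le> n \<Longrightarrow> degree M \<le> d \<Longrightarrow> ev M (\<beta> n) \<noteq> 0 \<Longrightarrow>
       1 \<le> norm (ev M (\<beta> n)) * W ^ (s n + 1) * len M ^ E"
proof -
  obtain C E where CE: "1 \<le> C"
    "\<And>Q N. ev Q \<alpha> \<noteq> 0 \<Longrightarrow> degree Q \<le> N \<Longrightarrow> 1 \<le> norm (ev Q \<alpha>) * C ^ (N + 1) * len Q ^ E"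
    using liouville_inequality[OF A \<alpha>] by metis
  define W where "W = C ^ (d + 1) * real L ^ (d * E)"
  have L': "1 \<le> real L" using L by simp
  have W: "1 \<le> W" unfolding W_def
    using mult_mono[OF one_le_power[OF CE(1), of "d + 1"] one_le_power[OF L', of "d * E"]] CE(1) by simp
  have "1 \<le> norm (ev M (\<beta> n)) * W ^ (s n + 1) * len M ^ E"
    if n: "1 \<le> n" and M: "degree M \<le> d" "ev M (\<beta> n) \<noteq> 0" for n M
  proof -
    define k where "k = s n + 1"
    define Q where "Q = pcompose M (G n)"
    have evQ: "ev Q \<alpha> = ev M (\<beta> n)" by (simp add: Q_def cpoly_pcompose poly_pcompose \<beta>_def)
    have "degree Q \<le> degree M * degree (G n)" unfolding Q_def by (rule degree_pcompose_le)
    also have "\<dots> \<le> d * s n" using M degree_G[OF n] by (intro mult_mono) auto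
    finally have degQ: "degree Q \<le> d * s n" .
    have Lk: "1 \<le> real L ^ k" using L by simp
    have "len Q \<le> len M * (real L ^ k) ^ degree M"
      unfolding Q_def cpoly_pcompose
      using poly_length_pcompose_le[of "cpoly (G n)" "real L ^ k" "cpoly M"] len_G[OF n] Lk
      by (simp add: k_def degree_cpoly)
    also have "\<dots> \<le> len M * (real L ^ k) ^ d"
      using M Lk by (intro mult_left_mono power_increasing) auto
    finally have lenQ: "len Q \<le> len M * (real L ^ k) ^ d" .
    have "1 \<le> norm (ev Q \<alpha>) * C ^ (d * s n + 1) * len Q ^ E"
      using CE(2)[of Q] M degQ by (simp add: evQ)
    also have "\<dots> \<le> norm (ev Q \<alpha>) * C ^ ((d + 1) * k) * (len M * (real L ^ k) ^ d) ^ E"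
      using CE(1) lenQ by (intro mult_mono power_mono power_increasing) (auto simp: k_def algebra_simps)
    also have "(len M * (real L ^ k) ^ d) ^ E = real L ^ (d * E * k) * len M ^ E"
      by (simp add: power_mult_distrib mult_ac flip: power_mult)
    also have "norm (ev Q \<alpha>) * C ^ ((d + 1) * k) * (real L ^ (d * E * k) * len M ^ E)
        = norm (ev Q \<alpha>) * (C ^ ((d + 1) * k) * real L ^ (d * E * k)) * len M ^ E"
      by (simp only: mult_ac)
    also have "C ^ ((d + 1) * k) * real L ^ (d * E * k) = W ^ k"
      by (simp only: W_def power_mult_distrib power_mult)
    also note evQ
    finally show ?thesis by (simp add: k_def)
  qed
  then show ?thesis using that W by blast
qed

text \<open>
All the numbers that are compared lie in the disc of this radius about the origin; the summand \<open>1\<close>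
makes room for every number at distance at most \<open>1\<close> from \<open>\<gamma>\<close>.
\<close>
definition R :: real where "R = norm \<gamma> + c + 1"

lemma R: "1 \<le> R" "norm \<gamma> \<le> R" and \<beta>_le_R: "1 \<le> n \<Longrightarrow> norm (\<beta> n) \<le> R"
proof -
  show "1 \<le> R" "norm \<gamma> \<le> R" using c by (auto simp: R_def)
  assume n: "1 \<le> n"
  have "q ^ t n \<le> 1" using q by (intro power_le_one) auto
  then have "c * q ^ t n \<le> c" using c by simp
  then have "norm (\<gamma> - \<beta> n) \<le> c" using \<beta>_close[OF n] by linarith
  then show "norm (\<beta> n) \<le> R"
    using norm_triangle_ineq2[of "\<beta> n" \<gamma>] unfolding R_def norm_minus_commute[of "\<beta> n"] by linarith
qed

text \<open>
The value \<open>M(\<beta> n) = M(\<beta> n) - M(\<xi>)\<close> is bounded below by Liouville's inequality and above by a Lipschitz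
estimate. Requiring only \<open>M(\<beta> n) \<noteq> 0\<close> in place of irreducibility makes the statement usable both for
\<open>\<xi> = \<gamma>\<close> and for numbers \<open>\<xi>\<close> of low degree.
\<close>
lemma separation:
  obtains W K :: real and E where "1 \<le> W" "0 \<le> K"
    "\<And>n M \<xi>. 1 \<le> n \<Longrightarrow> degree M \<le> d \<Longrightarrow> ev M (\<beta> n) \<noteq> 0 \<Longrightarrow> ev M \<xi> = 0 \<Longrightarrow> norm \<xi> \<le> R \<Longrightarrow>
       1 \<le> norm (\<beta> n - \<xi>) * K * W ^ (s n + 1) * len M ^ E"
proof -
  obtain W E where WE: "1 \<le> W"
    "\<And>n M. 1 \<le> n \<Longrightarrow> degree M \<le> d \<Longrightarrow> ev M (\<beta> n) \<noteq> 0 \<Longrightarrow>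
       1 \<le> norm (ev M (\<beta> n)) * W ^ (s n + 1) * len M ^ E"
    using \<beta>_lower_bound[of d] by metis
  define K where "K = real d * R ^ d"
  have K: "0 \<le> K" using R by (simp add: K_def)
  have "1 \<le> norm (\<beta> n - \<xi>) * K * W ^ (s n + 1) * len M ^ (E + 1)"
    if n: "1 \<le> n" and M: "degree M \<le> d" "ev M (\<beta> n) \<noteq> 0" and \<xi>: "ev M \<xi> = 0" "norm \<xi> \<le> R" for n M \<xi>
  proof -
    have "norm (ev M (\<beta> n)) = norm (ev M (\<beta> n) - ev M \<xi>)" using \<xi> by simp
    also have "\<dots> \<le> norm (\<beta> n - \<xi>) * len M * degree M * R ^ degree M"
      using norm_poly_diff_le[OF \<beta>_le_R[OF n] \<xi>(2) R(1), of "cpoly M"] by (simp add: degree_cpoly)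
    also have "\<dots> \<le> norm (\<beta> n - \<xi>) * len M * d * R ^ d"
      using M R by (intro mult_mono power_increasing mult_left_mono) auto
    finally have *: "norm (ev M (\<beta> n)) \<le> norm (\<beta> n - \<xi>) * len M * d * R ^ d" .
    have "1 \<le> norm (ev M (\<beta> n)) * W ^ (s n + 1) * len M ^ E" using WE(2) n M by blast
    also have "\<dots> \<le> norm (\<beta> n - \<xi>) * len M * d * R ^ d * W ^ (s n + 1) * len M ^ E"
      using * WE(1) by (intro mult_right_mono) auto
    finally show ?thesis by (simp add: K_def mult_ac)
  qed
  then show ?thesis using that WE(1) K by blast
qed

lemma eventually_constant_if_finite_range:
  assumes "finite (\<beta> ` {1..})"
  shows "\<exists>n0\<ge>1. \<forall>n\<ge>n0. \<beta> n = \<gamma>"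
proof -
  have "open (- (\<beta> ` {1..} - {\<gamma>}))" "\<gamma> \<in> - (\<beta> ` {1..} - {\<gamma>})"
    using assms by (simp_all add: open_Compl finite_imp_closed del: Compl_Diff_eq)
  then have "\<forall>\<^sub>F n in sequentially. \<beta> n \<in> - (\<beta> ` {1..} - {\<gamma>})"
    using \<beta>_tendsto by (rule topological_tendstoD[rotated])
  then obtain n0 where "\<And>n. n \<ge> n0 \<Longrightarrow> \<beta> n \<in> - (\<beta> ` {1..} - {\<gamma>})"
    by (auto simp: eventually_sequentially)
  then have "\<beta> n = \<gamma>" if "n \<ge> max n0 1" for n using that by auto
  then show ?thesis by (intro exI[of _ "max n0 1"]) auto
qed

end

text \<open>
If the approximations took finitely many values only, \<open>\<gamma>\<close> would be one of them and hence algebraic.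
\<close>
locale nonstationary_field_approximations = field_approximations +
  assumes infinite_range: "infinite (\<beta> ` {1..})"
begin

text \<open>
If \<open>M(\<gamma>) = 0\<close> with \<open>M \<noteq> 0\<close>, separation for \<open>\<xi> = \<gamma>\<close> contradicts the closeness of \<open>\<beta> n\<close> to \<open>\<gamma>\<close> unless
\<open>M(\<beta> n) = 0\<close>. So almost all \<open>\<beta> n\<close> are among the finitely many roots of \<open>M\<close>.
\<close>
lemma \<gamma>_transcendental: "\<not> algebraic \<gamma>"
proof
  assume "algebraic \<gamma>"
  then obtain M where M: "M \<noteq> 0" "ev M \<gamma> = 0" by (rule algebraicE')
  obtain W K E where WK: "1 \<le> W" "0 \<le> K"
    "\<And>n N \<xi>. 1 \<le> n \<Longrightarrow> degree N \<le> degree M \<Longrightarrow> ev N (\<beta> n) \<noteq> 0 \<Longrightarrow> ev N \<xi> = 0 \<Longrightarrow> norm \<xi> \<le> R \<Longrightarrow>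
       1 \<le> norm (\<beta> n - \<xi>) * K * W ^ (s n + 1) * len N ^ E"
    using separation[of "degree M"] by metis
  define K' where "K' = c * K * len M ^ E"
  have "0 \<le> K'" using WK c by (simp add: K'_def)
  from decay[OF q WK(1) this] obtain n0 where n0: "n0 \<ge> 1"
    "\<And>n. n \<ge> n0 \<Longrightarrow> K' * q ^ t n * W ^ (s n + 1) < 1" by blast
  have "ev M (\<beta> n) = 0" if n: "n \<ge> n0" for n
  proof (rule ccontr)
    assume "ev M (\<beta> n) \<noteq> 0"
    then have "1 \<le> norm (\<beta> n - \<gamma>) * K * W ^ (s n + 1) * len M ^ E"
      using WK(3)[of n M \<gamma>] M R n n0 by auto
    also have "\<dots> \<le> c * q ^ t n * K * W ^ (s n + 1) * len M ^ E"
      using \<beta>_close[of n] n n0(1) WK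
      by (intro mult_right_mono) (auto simp: norm_minus_commute)
    also have "\<dots> = K' * q ^ t n * W ^ (s n + 1)" by (simp add: K'_def mult_ac)
    finally show False using n0(2)[OF n] by linarith
  qed
  then have "\<beta> ` {1..} \<subseteq> \<beta> ` {1..<n0} \<union> {z. ev M z = 0}" by (auto simp: not_less image_iff)
      (metis atLeastLessThan_iff linorder_not_le)
  moreover have "finite (\<beta> ` {1..<n0} \<union> {z. ev M z = 0})"
    using M by (auto intro: poly_roots_finite simp: cpoly_eq_0_iff)
  ultimately have "finite (\<beta> ` {1..})" by (rule finite_subset)
  then show False using infinite_range by simp
qed

definition degree_recurs :: "nat \<Rightarrow> bool" where
  "degree_recurs d \<longleftrightarrow> infinite {z \<in> \<beta> ` {1..}. algebraic_of_degree z d}"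

text \<open>
The degrees of the approximations are bounded by the degree of \<open>\<alpha>\<close>, so one of finitely many degrees
accounts for infinitely many values.
\<close>
lemma ex_degree_recurs: "\<exists>d>0. degree_recurs d"
proof (rule ccontr)
  assume *: "\<not> (\<exists>d>0. degree_recurs d)"
  obtain H where H: 
    "\<And>n. 1 \<le> n \<Longrightarrow> \<exists>M. is_int_min_poly M (\<beta> n) \<and> degree M \<le> degree A \<and> len M \<le> real H ^ (s n + 1)"
    using \<beta>_min_poly by metis
  have "\<beta> ` {1..} \<subseteq> (\<Union>d\<in>{1..degree A}. {z \<in> \<beta> ` {1..}. algebraic_of_degree z d})"
  proof
    fix z assume z: "z \<in> \<beta> ` {1..}"
    then obtain n where "1 \<le> n" "z = \<beta> n" by auto
    then obtain M where M: "is_int_min_poly M z" "degree M \<le> degree A" using H by blast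
    then have min: "minimal_annihilator M z" by (intro int_min_poly_minimal)
    then have "algebraic_of_degree z (degree M)" by (auto simp: algebraic_of_degree_iff)
    moreover have "0 < degree M"
      using min by (auto simp: minimal_annihilator_def intro: degree_pos_if_ev_eq_0)
    ultimately show "z \<in> (\<Union>d\<in>{1..degree A}. {z \<in> \<beta> ` {1..}. algebraic_of_degree z d})"
      using z M(2) by (intro UN_I[of "degree M"]) auto
  qed
  moreover have "finite (\<Union>d\<in>{1..degree A}. {z \<in> \<beta> ` {1..}. algebraic_of_degree z d})"
  proof (rule finite_UN_I)
    fix d assume "d \<in> {1..degree A}"
    then have "0 < d" by simp
    then have "\<not> degree_recurs d" using * by blast
    then show "finite {z \<in> \<beta> ` {1..}. algebraic_of_degree z d}" by (simp add: degree_recurs_def)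
  qed simp
  ultimately have "finite (\<beta> ` {1..})" by (rule finite_subset)
  then show False using infinite_range by simp
qed

text \<open>
The \<open>w\<close>-th power of the height of \<open>\<beta> n\<close> is at most exponential in \<open>s n\<close>, so almost all approximations
satisfy the required inequality.
\<close>
lemma degree_recurs_imp_well_approximable:
  assumes "degree_recurs m"
  shows "well_approximable \<gamma> m"
  unfolding well_approximable_def
proof (intro allI impI)
  fix w :: real assume w: "w > 0"
  obtain H where H: "1 \<le> H"
    "\<And>n. 1 \<le> n \<Longrightarrow> \<exists>M. is_int_min_poly M (\<beta> n) \<and> degree M \<le> degree A \<and> len M \<le> real H ^ (s n + 1)"
    using \<beta>_min_poly by metis
  define X where "X = real H powr w"
  have X: "1 \<le> X" using H w by (simp add: X_def ge_one_powr_ge_zero)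
  from decay[OF q X less_imp_le[OF c]] obtain n0 where n0: "n0 \<ge> 1"
    "\<And>n. n \<ge> n0 \<Longrightarrow> c * q ^ t n * X ^ (s n + 1) < 1" by blast
  let ?S = "{\<beta>. algebraic_of_degree \<beta> m \<and>
          (\<exists>M. is_int_min_poly M \<beta> \<and> cmod (\<gamma> - \<beta>) < real_of_int (poly_height M) powr (- w))}"
  have "{z \<in> \<beta> ` {1..}. algebraic_of_degree z m} - \<beta> ` {1..<n0} \<subseteq> ?S"
  proof
    fix z assume z: "z \<in> {z \<in> \<beta> ` {1..}. algebraic_of_degree z m} - \<beta> ` {1..<n0}"
    then obtain n where n: "1 \<le> n" "z = \<beta> n" by auto
    then have nn: "n \<ge> n0" using z by (auto simp: image_iff not_less)
    obtain M where M: "is_int_min_poly M z" "len M \<le> real H ^ (s n + 1)" using H(2)[OF n(1)] n(2) by blast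
    then have M0: "M \<noteq> 0" by (auto simp: is_int_min_poly_def)
    have h1: "1 \<le> real_of_int (poly_height M)" using one_le_poly_height[OF M0] by simp
    have "real_of_int (poly_height M) powr w \<le> (real H ^ (s n + 1)) powr w"
      using poly_height_le_len[OF M0] M(2) h1 w by (intro powr_mono2) auto
    also have "\<dots> = (real H powr real (s n + 1)) powr w"
      using H(1) by (simp only: powr_realpow)
    also have "\<dots> = X powr real (s n + 1)" by (simp only: X_def powr_powr mult.commute)
    also have "\<dots> = X ^ (s n + 1)" using X by (intro powr_realpow) simp
    finally have hX: "real_of_int (poly_height M) powr w \<le> X ^ (s n + 1)" .
    have "norm (\<gamma> - z) * real_of_int (poly_height M) powr w \<le> c * q ^ t n * X ^ (s n + 1)"
      using hX \<beta>_close[OF n(1)] n(2) c q by (intro mult_mono) auto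
    also have "\<dots> < 1" by (rule n0(2)[OF nn])
    finally have "norm (\<gamma> - z) < real_of_int (poly_height M) powr (- w)"
      using h1 by (simp add: powr_minus field_simps)
    then show "z \<in> ?S" using z M(1) by blast
  qed
  moreover have "infinite ({z \<in> \<beta> ` {1..}. algebraic_of_degree z m} - \<beta> ` {1..<n0})"
    using assms by (intro Diff_infinite_finite) (auto simp: degree_recurs_def)
  ultimately show "infinite ?S" using finite_subset by blast
qed

text \<open>
The values of degree less than \<open>m\<close> are finitely many algebraic numbers. They keep a positive distance
from the transcendental limit \<open>\<gamma>\<close>, so they are not attained for large \<open>n\<close>.
\<close>
lemma eventually_large_degree:
  assumes "\<And>d. 0 < d \<Longrightarrow> d < m \<Longrightarrow> \<not> degree_recurs d"
  shows "\<exists>n0\<ge>1. \<forall>n\<ge>n0. \<forall>M. M \<noteq> 0 \<and> degree M < m \<longrightarrow> ev M (\<beta> n) \<noteq> 0"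
proof -
  define F where "F = (\<Union>d\<in>{0<..<m}. {z \<in> \<beta> ` {1..}. algebraic_of_degree z d})"
  have "finite F" unfolding F_def using assms by (auto simp: degree_recurs_def)
  moreover have "\<gamma> \<notin> F"
  proof
    assume "\<gamma> \<in> F"
    then obtain B where "minimal_annihilator B \<gamma>" by (auto simp: F_def algebraic_of_degree_iff)
    then show False using \<gamma>_transcendental annihilator_imp_algebraic by (auto simp: minimal_annihilator_def)
  qed
  ultimately have "open (- F)" "\<gamma> \<in> - F" by (auto intro: finite_imp_closed)
  then have "\<forall>\<^sub>F n in sequentially. \<beta> n \<in> - F" using \<beta>_tendsto by (rule topological_tendstoD[rotated])
  then obtain n1 where n1: "\<And>n. n \<ge> n1 \<Longrightarrow> \<beta> n \<notin> F" by (auto simp: eventually_sequentially)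
  have "ev M (\<beta> n) \<noteq> 0" if n: "n \<ge> max n1 1" and M: "M \<noteq> 0" "degree M < m" for n M
  proof
    assume 0: "ev M (\<beta> n) = 0"
    then obtain B where B: "minimal_annihilator B (\<beta> n)" using minimal_annihilator_exists M by blast
    then have "degree B \<le> degree M" "0 < degree B" using M 0
      by (auto simp: minimal_annihilator_def intro: degree_pos_if_ev_eq_0)
    then have "\<beta> n \<in> F" using B M n unfolding F_def
      by (intro UN_I[of "degree B"]) (auto simp: algebraic_of_degree_iff)
    then show False using n1 n by auto
  qed
  then show ?thesis by (intro exI[of _ "max n1 1"]) auto
qed

text \<open>
Let \<open>\<xi>\<close> have degree \<open>d\<close> and height \<open>h\<close>. Since \<open>M(\<beta> n) \<noteq> 0\<close> for the minimal polynomial \<open>M\<close> of \<open>\<xi>\<close>,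
separation bounds \<open>\<bar>\<gamma> - \<beta> n\<bar> + \<bar>\<gamma> - \<xi>\<bar>\<close> below for every large \<open>n\<close>. Take the first \<open>n\<close> for which \<open>t n\<close>
exceeds a suitable multiple of \<open>log h\<close>; then \<open>\<bar>\<gamma> - \<beta> n\<bar>\<close> accounts for at most half of the bound. By
minimality \<open>t (n - 1)\<close> is \<open>O(log h)\<close>, and so is \<open>s n\<close> because \<open>s n / t (n - 1)\<close> is bounded. The
exponential in \<open>s n\<close> in the bound thus becomes a power of \<open>h\<close>. Choosing the exponent \<open>w\<close> larger than
all the powers of \<open>h\<close> that occur bounds \<open>h\<close>, which leaves finitely many \<open>\<xi>\<close>.
\<close>
lemma not_well_approximable_below:
  assumes small: "\<And>d. 0 < d \<Longrightarrow> d < m \<Longrightarrow> \<not> degree_recurs d" and d: "d < m"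
  shows "\<not> well_approximable \<gamma> d"
proof -
  obtain n0 where n0: "n0 \<ge> 1"
    "\<And>n M. n \<ge> n0 \<Longrightarrow> M \<noteq> 0 \<Longrightarrow> degree M < m \<Longrightarrow> ev M (\<beta> n) \<noteq> 0"
    using eventually_large_degree[of m, OF small] by blast
  obtain W K E where WK: "1 \<le> W" "0 \<le> K"
    "\<And>n M \<xi>. 1 \<le> n \<Longrightarrow> degree M \<le> d \<Longrightarrow> ev M (\<beta> n) \<noteq> 0 \<Longrightarrow> ev M \<xi> = 0 \<Longrightarrow> norm \<xi> \<le> R \<Longrightarrow>
       1 \<le> norm (\<beta> n - \<xi>) * K * W ^ (s n + 1) * len M ^ E"
    using separation[of d] by metis
  \<comment> \<open>The error is split as q ^ t n = p ^ t n * p ^ t n: one factor absorbs the exponential in s n,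
    the other one the power of the height.\<close>
  define p where "p = sqrt q"
  have p: "0 < p" "p < 1" and pp: "q = p * p" using q by (auto simp: p_def)
  define K1 where "K1 = 2 * K * real (d + 1) ^ E"
  have K1: "0 \<le> K1" using WK by (simp add: K1_def)
  then have "0 \<le> c * K1" using c by simp
  from decay[OF p WK(1) this] obtain n1 where n1: "n1 \<ge> 1"
    "\<And>n. n \<ge> n1 \<Longrightarrow> c * K1 * p ^ t n * W ^ (s n + 1) < 1" by blast
  define N where "N = max n0 n1"
  have "(\<lambda>k. p ^ k) \<longlonglongrightarrow> 0" using p by (intro LIMSEQ_realpow_zero) auto
  then have "\<forall>\<^sub>F k in sequentially. p ^ k < 1 / 2" by (intro order_tendstoD) auto
  then obtain u where u: "p ^ u < 1 / 2" by (auto simp: eventually_sequentially)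
  obtain V where V: "W ^ (b * u * E) < 2 ^ V"
    using real_arch_pow[of 2 "W ^ (b * u * E)"] by auto
  define K2 where "K2 = K1 * W ^ (s N + 1) * 2 ^ V"
  define w where "w = V + E + 1"
  have height: "real_of_int (poly_height M) \<le> K2"
    if deg: "algebraic_of_degree \<xi> d" and M: "is_int_min_poly M \<xi>"
      and app: "norm (\<gamma> - \<xi>) < real_of_int (poly_height M) powr (- real w)" for \<xi> M
  proof -
    have min: "minimal_annihilator M \<xi>" using M by (rule int_min_poly_minimal)
    then have M0: "M \<noteq> 0" "ev M \<xi> = 0" by (auto simp: minimal_annihilator_def)
    have dM: "degree M = d"
      using deg min minimal_annihilator_degree_unique unfolding algebraic_of_degree_iff by blast
    define h where "h = real_of_int (poly_height M)"
    have h: "1 \<le> h" using one_le_poly_height[OF M0(1)] by (simp add: h_def)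
    define \<delta> where "\<delta> = norm (\<gamma> - \<xi>)"
    have \<delta>0: "0 \<le> \<delta>" by (simp add: \<delta>_def)
    have "h powr (- real w) = 1 / h ^ w" using h by (simp add: powr_minus powr_realpow divide_inverse)
    then have \<delta>: "\<delta> < 1 / h ^ w" using app by (simp add: \<delta>_def h_def)
    have "1 / h ^ w \<le> 1" using h by simp
    then have "\<delta> \<le> 1" using \<delta> by linarith
    then have \<xi>R: "norm \<xi> \<le> R"
      using norm_triangle_ineq2[of \<xi> \<gamma>] c unfolding R_def \<delta>_def norm_minus_commute[of \<xi>] by linarith
    have lenM: "len M \<le> real (d + 1) * h"
      using len_le_poly_height[OF M0(1)] dM by (simp add: h_def)
    have low: "2 \<le> (c * q ^ t n + \<delta>) * (K1 * W ^ (s n + 1) * h ^ E)" if n: "n \<ge> N" for n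
    proof -
      have n': "n \<ge> n0" "n \<ge> 1" using n n0 by (auto simp: N_def)
      have "norm (\<beta> n - \<xi>) \<le> norm (\<gamma> - \<beta> n) + norm (\<gamma> - \<xi>)"
        by (metis dist_commute dist_norm dist_triangle2 dist_triangle)
      also have "\<dots> \<le> c * q ^ t n + \<delta>" using \<beta>_close[OF n'(2)] by (simp add: \<delta>_def)
      finally have near: "norm (\<beta> n - \<xi>) \<le> c * q ^ t n + \<delta>" .
      have "1 \<le> norm (\<beta> n - \<xi>) * K * W ^ (s n + 1) * len M ^ E"
        using WK(3)[OF n'(2), of M \<xi>] n0(2)[OF n'(1) M0(1)] M0(2) \<xi>R dM d by simp
      also have "\<dots> \<le> (c * q ^ t n + \<delta>) * K * W ^ (s n + 1) * (real (d + 1) * h) ^ E"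
        using near lenM WK(1,2) \<delta>0 c q h by (intro mult_mono power_mono) auto
      also have "\<dots> = (c * q ^ t n + \<delta>) * (K1 * W ^ (s n + 1) * h ^ E) / 2"
        by (simp only: K1_def power_mult_distrib) simp
      finally show ?thesis by simp
    qed
    \<comment> \<open>j is an integral substitute for the logarithm of h to the base 2.\<close>
    define j where "j = (LEAST j. h \<le> 2 ^ j)"
    have "\<exists>j. h \<le> 2 ^ j" using real_arch_pow[of 2 h] by (auto intro: less_imp_le)
    then have hj: "h \<le> 2 ^ j" unfolding j_def by (rule LeastI_ex)
    have jh: "2 ^ j \<le> 2 * h"
    proof (cases j)
      case 0
      then show ?thesis using h by simp
    next
      case (Suc i)
      then have "\<not> h \<le> 2 ^ i" using not_less_Least[of i "\<lambda>j. h \<le> 2 ^ j"] unfolding j_def[symmetric] by simp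
      then show ?thesis using Suc by simp
    qed
    define P where "P n \<longleftrightarrow> n \<ge> N \<and> u * j * E \<le> t n" for n
    define n where "n = (LEAST n. P n)"
    have "1 \<le> max N (u * j * E)" using n0(1) by (auto simp: N_def)
    then have "P (max N (u * j * E))"
      using le_s[of "max N (u * j * E)"] s_le_t[of "max N (u * j * E)"] by (simp add: P_def)
    then have n: "P n" unfolding n_def by (rule LeastI)
    then have nN: "n \<ge> N" and tn: "u * j * E \<le> t n" by (auto simp: P_def)
    \<comment> \<open>Either n is the fixed index N, or t (n - 1) is still below the threshold.\<close>
    have sn: "s n + 1 \<le> (s N + 1) + b * u * E * j"
    proof (cases "n = N")
      case False
      then obtain k where k: "n = Suc k" "k \<ge> N" using nN by (cases n) auto
      have "\<not> P k" using not_less_Least[of k P] k unfolding n_def[symmetric] by simp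
      then have "t k \<le> u * j * E" using k by (simp add: P_def)
      then have "b * t k \<le> b * (u * j * E)" by (rule mult_le_mono2)
      moreover have "s n \<le> b * t k" using s_le_bt[of k] k n0(1) by (simp add: N_def)
      ultimately have "s n \<le> b * (u * j * E)" by linarith
      then have "s n \<le> b * u * E * j" by (simp only: mult_ac)
      then show ?thesis by simp
    qed simp
    have "p ^ t n * h ^ E \<le> p ^ (u * (j * E)) * (2 ^ j) ^ E"
      using tn p hj h by (intro mult_mono power_mono power_decreasing) (auto simp: mult_ac)
    also have "\<dots> = (p ^ u * 2) ^ (j * E)"
      by (simp add: power_mult_distrib power_mult)
    also have "\<dots> \<le> 1" using u p by (intro power_le_one) auto
    finally have small: "p ^ t n * h ^ E \<le> 1" .
    have "c * q ^ t n * (K1 * W ^ (s n + 1) * h ^ E)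
        = (c * K1 * p ^ t n * W ^ (s n + 1)) * (p ^ t n * h ^ E)"
      by (simp only: pp power_mult_distrib mult_ac)
    also have "\<dots> \<le> 1 * 1"
      using small n1(2)[of n] nN p h K1 WK(1) c by (intro mult_mono) (auto simp: N_def)
    finally have "1 \<le> \<delta> * (K1 * W ^ (s n + 1) * h ^ E)"
      using low[OF nN] by (simp add: distrib_right)
    also have "\<dots> \<le> \<delta> * (K2 * h ^ (V + E))"
    proof (rule mult_left_mono[OF _ \<delta>0])
      have "W ^ (s n + 1) \<le> W ^ ((s N + 1) + b * u * E * j)"
        using sn WK(1) by (intro power_increasing) auto
      also have "\<dots> = W ^ (s N + 1) * (W ^ (b * u * E)) ^ j"
        by (simp only: power_add power_mult)
      also have "\<dots> \<le> W ^ (s N + 1) * (2 ^ V) ^ j"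
        using V WK(1) by (intro mult_left_mono power_mono) auto
      also have "(2 ^ V) ^ j = (2 ^ j :: real) ^ V" by (simp add: mult.commute flip: power_mult)
      also have "W ^ (s N + 1) * (2 ^ j) ^ V \<le> W ^ (s N + 1) * (2 * h) ^ V"
        using jh WK(1) by (intro mult_left_mono power_mono) auto
      finally have "K1 * W ^ (s n + 1) * h ^ E \<le> K1 * (W ^ (s N + 1) * (2 * h) ^ V) * h ^ E"
        using K1 h by (intro mult_right_mono mult_left_mono) auto
      also have "\<dots> = K2 * h ^ (V + E)"
        by (simp only: K2_def power_mult_distrib power_add mult_ac)
      finally show "K1 * W ^ (s n + 1) * h ^ E \<le> K2 * h ^ (V + E)" .
    qed
    also have "\<dots> \<le> 1 / h ^ w * (K2 * h ^ (V + E))"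
      using \<delta> K1 WK(1) h by (intro mult_right_mono) (auto simp: K2_def)
    also have "\<dots> = K2 / h" using h by (simp add: w_def field_simps power_add)
    finally show ?thesis using h by (simp add: h_def field_simps)
  qed
  let ?S = "{\<beta>. algebraic_of_degree \<beta> d \<and>
    (\<exists>M. is_int_min_poly M \<beta> \<and> cmod (\<gamma> - \<beta>) < real_of_int (poly_height M) powr (- real w))}"
  have "?S \<subseteq> {\<beta>. \<exists>M. M \<noteq> 0 \<and> degree M \<le> d \<and> poly_height M \<le> \<lceil>K2\<rceil> \<and> ev M \<beta> = 0}"
  proof
    fix \<xi> assume "\<xi> \<in> ?S"
    then obtain M where M: "algebraic_of_degree \<xi> d" "is_int_min_poly M \<xi>"
      "cmod (\<gamma> - \<xi>) < real_of_int (poly_height M) powr (- real w)" by blast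
    have min: "minimal_annihilator M \<xi>" using M(2) by (rule int_min_poly_minimal)
    then have "degree M = d"
      using M(1) minimal_annihilator_degree_unique unfolding algebraic_of_degree_iff by blast
    moreover have "poly_height M \<le> \<lceil>K2\<rceil>" using height[OF M] by linarith
    ultimately show "\<xi> \<in> {\<beta>. \<exists>M. M \<noteq> 0 \<and> degree M \<le> d \<and> poly_height M \<le> \<lceil>K2\<rceil> \<and> ev M \<beta> = 0}"
      using min unfolding minimal_annihilator_def by auto
  qed
  then have "finite ?S" using finite_roots_bounded_height by (rule finite_subset)
  moreover have "0 < real w" by (simp add: w_def)
  ultimately show ?thesis unfolding well_approximable_def by blast
qed

lemma U_number_of_first_recurring_degree:
  "\<exists>m. smallest_positive degree_recurs m \<and> \<gamma> \<in> U_numbers m"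
proof -
  define m where "m = (LEAST d. 0 < d \<and> degree_recurs d)"
  have m: "0 < m \<and> degree_recurs m" unfolding m_def using ex_degree_recurs by (rule LeastI_ex)
  have less: "\<not> degree_recurs d" if "0 < d" "d < m" for d
    using not_less_Least[of d "\<lambda>d. 0 < d \<and> degree_recurs d"] that unfolding m_def by blast
  have "smallest_positive (well_approximable \<gamma>) m"
    unfolding smallest_positive_def
    using m degree_recurs_imp_well_approximable not_well_approximable_below[of m] less by blast
  then have "\<gamma> \<in> U_numbers m" using \<gamma>_transcendental by (simp add: U_numbers_def)
  moreover have "smallest_positive degree_recurs m"
    using m less by (auto simp: smallest_positive_def)
  ultimately show ?thesis by blast
qed

end

section \<open>Truncations of generalized Liouville series\<close>

lemma liouville_sequencesD:
  assumes "liouville_sequences f s t"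
  shows "\<And>n. 1 \<le> n \<Longrightarrow> s n < t n" "\<And>n. 1 \<le> n \<Longrightarrow> t (n - 1) \<le> s n"
    "\<And>n k. 1 \<le> n \<Longrightarrow> s n < k \<Longrightarrow> k < t n \<Longrightarrow> fps_nth f k = 0"
    "filterlim (\<lambda>n. real (t n) / real (s n)) at_top sequentially"
    "bounded ((\<lambda>n. real (s (n + 1)) / real (t n)) ` {1..})"
  using assms by (auto simp: liouville_sequences_def)

text \<open>
At a point of absolute value at least \<open>1\<close> the terms with nonzero integer coefficients do not tend
to \<open>0\<close>.
\<close>
lemma norm_less_one_if_inside_disc:
  fixes f :: "int fps"
  assumes "infinite {k. fps_nth f k \<noteq> 0}"
    and "ereal (cmod \<alpha>) < fps_conv_radius (complex_fps f)"
  shows "cmod \<alpha> < 1"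
proof (rule ccontr)
  assume "\<not> cmod \<alpha> < 1"
  have "(\<lambda>k. norm (fps_nth (complex_fps f) k * \<alpha> ^ k)) \<longlonglongrightarrow> 0"
    using norm_summable_fps[OF assms(2)] by (rule summable_LIMSEQ_zero)
  then have "\<forall>\<^sub>F k in sequentially. norm (fps_nth (complex_fps f) k * \<alpha> ^ k) < 1"
    by (rule order_tendstoD) simp
  then obtain k0 where k0: "\<And>k. k \<ge> k0 \<Longrightarrow> norm (fps_nth (complex_fps f) k * \<alpha> ^ k) < 1"
    by (auto simp: eventually_sequentially)
  obtain k where k: "k \<ge> k0" "fps_nth f k \<noteq> 0"
    using assms(1) unfolding infinite_nat_iff_unbounded_le by blast
  then have "1 \<le> \<bar>fps_nth f k\<bar>" by linarith
  then have "1 \<le> \<bar>real_of_int (fps_nth f k)\<bar>" by linarith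
  moreover have "1 \<le> cmod \<alpha> ^ k" using \<open>\<not> cmod \<alpha> < 1\<close> by (intro one_le_power) simp
  ultimately have "1 * 1 \<le> \<bar>real_of_int (fps_nth f k)\<bar> * cmod \<alpha> ^ k" by (intro mult_mono) auto
  then show False using k0[OF k(1)] by (simp add: complex_fps_def norm_mult norm_power)
qed

text \<open>
Both bounds come from the boundedness of the terms at some radius strictly between \<open>\<bar>\<alpha>\<bar>\<close> and the
radius of convergence.
\<close>
lemma geometric_coefficient_bounds:
  fixes f :: "int fps"
  assumes "ereal (cmod \<alpha>) < fps_conv_radius (complex_fps f)"
  obtains C \<rho> q :: real where "1 \<le> C" "1 \<le> \<rho>" "0 < q" "q < 1"
    "\<And>k. \<bar>real_of_int (fps_nth f k)\<bar> \<le> C * \<rho> ^ k"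
    "\<And>k. cmod (of_int (fps_nth f k) * \<alpha> ^ k) \<le> C * q ^ k"
proof -
  obtain r where r: "cmod \<alpha> < r" "ereal r < fps_conv_radius (complex_fps f)"
    using ereal_dense2[OF assms] by auto
  have r0: "0 < r" using r(1) norm_ge_zero[of \<alpha>] by linarith
  have "summable (\<lambda>k. norm (fps_nth (complex_fps f) k * of_real r ^ k))"
    using r(2) r0 by (intro norm_summable_fps) simp
  then have "Bseq (\<lambda>k. norm (fps_nth (complex_fps f) k * of_real r ^ k))"
    by (meson convergent_imp_Bseq convergentI summable_LIMSEQ_zero)
  then obtain C0 where C0: "\<And>k. norm (norm (fps_nth (complex_fps f) k * of_real r ^ k)) \<le> C0"
    by (auto simp: Bseq_def)
  define C where "C = max 1 C0"
  have C: "\<bar>real_of_int (fps_nth f k)\<bar> * r ^ k \<le> C" for k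
    using C0[of k] r0 by (auto simp: C_def complex_fps_def norm_mult norm_power le_max_iff_disj)
  define \<rho> where "\<rho> = max 1 (1 / r)"
  define q where "q = max (1 / 2) (cmod \<alpha> / r)"
  show ?thesis
  proof (rule that[of C \<rho> q])
    fix k
    have "\<bar>real_of_int (fps_nth f k)\<bar> = \<bar>real_of_int (fps_nth f k)\<bar> * r ^ k * (1 / r) ^ k"
      using r0 by (simp add: field_simps)
    also have "\<dots> \<le> C * \<rho> ^ k"
      using C[of k] r0 by (intro mult_mono power_mono) (auto simp: C_def \<rho>_def)
    finally show "\<bar>real_of_int (fps_nth f k)\<bar> \<le> C * \<rho> ^ k" .
    have "cmod (of_int (fps_nth f k) * \<alpha> ^ k)
        = \<bar>real_of_int (fps_nth f k)\<bar> * r ^ k * (cmod \<alpha> / r) ^ k"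
      using r0 by (simp add: norm_mult norm_power field_simps)
    also have "\<dots> \<le> C * q ^ k"
      using C[of k] r0 by (intro mult_mono power_mono) (auto simp: C_def q_def)
    finally show "cmod (of_int (fps_nth f k) * \<alpha> ^ k) \<le> C * q ^ k" .
  qed (use r r0 in \<open>auto simp: C_def \<rho>_def q_def\<close>)
qed

definition trunc_poly :: "int fps \<Rightarrow> (nat \<Rightarrow> nat) \<Rightarrow> nat \<Rightarrow> int poly" where
  "trunc_poly f s n = (\<Sum>k\<le>s n. monom (fps_nth f k) k)"

lemma ev_trunc_poly: "ev (trunc_poly f s n) z = truncation f s n z"
  by (simp add: trunc_poly_def truncation_def cpoly_simps poly_sum poly_monom atMost_atLeast0)

lemma degree_trunc_poly: "degree (trunc_poly f s n) \<le> s n"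
  unfolding trunc_poly_def by (intro degree_sum_le) (auto intro: order_trans[OF degree_monom_le])

lemma len_trunc_poly:
  assumes "\<And>k. \<bar>real_of_int (fps_nth f k)\<bar> \<le> C * \<rho> ^ k" "1 \<le> C" "1 \<le> \<rho>"
  shows "len (trunc_poly f s n) \<le> (2 * C * \<rho>) ^ (s n + 1)"
proof -
  define k where "k = s n + 1"
  have "len (trunc_poly f s n) \<le> (\<Sum>k\<le>s n. len (monom (fps_nth f k) k))"
    unfolding trunc_poly_def cpoly_sum by (rule poly_length_sum)
  also have "\<dots> \<le> (\<Sum>i\<le>s n. C * \<rho> ^ k)"
  proof (rule sum_mono)
    fix i assume "i \<in> {..s n}"
    then have "C * \<rho> ^ i \<le> C * \<rho> ^ k"
      using assms by (intro mult_left_mono power_increasing) (auto simp: k_def)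
    then show "len (monom (fps_nth f i) i) \<le> C * \<rho> ^ k"
      using assms(1)[of i] by (simp add: cpoly_monom)
  qed
  also have "\<dots> = real k * (C * \<rho> ^ k)" by (simp add: k_def)
  also have "\<dots> \<le> 2 ^ k * (C ^ k * \<rho> ^ k)"
  proof (intro mult_mono)
    show "real k \<le> 2 ^ k" using of_nat_less_two_power[of k, where 'a = real] by simp
    show "C \<le> C ^ k" using power_increasing[of 1 k C] assms by (simp add: k_def)
  qed (use assms in auto)
  also have "\<dots> = (2 * C * \<rho>) ^ k" by (simp only: power_mult_distrib mult.assoc)
  finally show ?thesis by (simp only: k_def)
qed

text \<open>
The coefficients strictly between \<open>s n\<close> and \<open>t n\<close> vanish, so the error is the tail of the series from
\<open>t n\<close> on.
\<close>
lemma truncation_error: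
  assumes seq: "liouville_sequences f s t"
    and \<alpha>: "ereal (cmod \<alpha>) < fps_conv_radius (complex_fps f)"
    and q: "0 < q" "q < 1"
    and bound: "\<And>k. cmod (of_int (fps_nth f k) * \<alpha> ^ k) \<le> C * q ^ k"
    and n: "1 \<le> n"
  shows "cmod (eval_fps (complex_fps f) \<alpha> - truncation f s n \<alpha>) \<le> C / (1 - q) * q ^ t n"
proof -
  define x where "x k = of_int (fps_nth f k) * \<alpha> ^ k" for k
  have x: "summable x" using summable_fps[OF \<alpha>] by (simp add: x_def[abs_def] complex_fps_def)
  have "eval_fps (complex_fps f) \<alpha> = suminf x"
    by (simp add: eval_fps_def x_def[abs_def] complex_fps_def)
  also have "\<dots> = (\<Sum>k. x (k + t n)) + (\<Sum>k<t n. x k)" by (rule suminf_split_initial_segment[OF x])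
  also have "(\<Sum>k<t n. x k) = (\<Sum>k=0..s n. x k)"
    using liouville_sequencesD(1,3)[OF seq, of n] n by (intro sum.mono_neutral_right) (auto simp: x_def)
  also have "\<dots> = truncation f s n \<alpha>" by (simp add: truncation_def x_def)
  finally have eq: "eval_fps (complex_fps f) \<alpha> - truncation f s n \<alpha> = (\<Sum>k. x (k + t n))" by simp
  have g: "(\<lambda>k. C * q ^ t n * q ^ k) sums (C * q ^ t n * (1 / (1 - q)))"
    using q by (intro sums_mult geometric_sums) auto
  have "cmod (\<Sum>k. x (k + t n)) \<le> (\<Sum>k. C * q ^ t n * q ^ k)"
  proof (rule norm_suminf_le)
    show "cmod (x (k + t n)) \<le> C * q ^ t n * q ^ k" for k
      using bound[of "k + t n"] by (simp add: x_def power_add mult_ac)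
    show "summable (\<lambda>k. C * q ^ t n * q ^ k)" using g by (rule sums_summable)
  qed
  also have "\<dots> = C * q ^ t n * (1 / (1 - q))" using g by (rule sums_unique[symmetric])
  finally show ?thesis unfolding eq by simp
qed

lemma truncation_step:
  assumes seq: "liouville_sequences f s t" and n: "1 \<le> n"
  shows "truncation f s (Suc n) z = truncation f s n z + block f s t (Suc n) z"
proof -
  define x where "x k = of_int (fps_nth f k) * z ^ k" for k
  have st: "s n < t n" "t n \<le> s (Suc n)"
    using liouville_sequencesD(1)[OF seq n] liouville_sequencesD(2)[OF seq, of "Suc n"] by auto
  have "{0..s (Suc n)} = {0..s n} \<union> {Suc (s n)..s (Suc n)}" using st by auto
  then have "(\<Sum>k=0..s (Suc n). x k) = (\<Sum>k=0..s n. x k) + (\<Sum>k=Suc (s n)..s (Suc n). x k)"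
    by (simp add: sum.union_disjoint)
  also have "(\<Sum>k=Suc (s n)..s (Suc n). x k) = (\<Sum>k=t n..s (Suc n). x k)"
    using st liouville_sequencesD(3)[OF seq n]
    by (intro sum.mono_neutral_right) (auto simp: x_def)
  finally show ?thesis by (simp add: truncation_def block_def x_def)
qed

theorem theorem1p3:
  fixes f :: "int fps" and s t :: "nat \<Rightarrow> nat" and \<alpha> :: complex
  assumes "generalized_liouville_series f"
    and "liouville_sequences f s t"
    and "algebraic \<alpha>"
    and "ereal (cmod \<alpha>) < fps_conv_radius (complex_fps f)"
    and "infinite {n. n \<ge> 1 \<and> block f s t n \<alpha> \<noteq> 0}"
  shows "\<exists>m. smallest_positive
               (\<lambda>d. infinite {\<beta> \<in> (\<lambda>n. truncation f s n \<alpha>) ` {1..}. algebraic_of_degree \<beta> d}) m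
             \<and> eval_fps (complex_fps f) \<alpha> \<in> U_numbers m"
proof -
  note seq = liouville_sequencesD[OF assms(2)]
  have \<alpha>: "cmod \<alpha> < 1"
    using assms(1,4) by (intro norm_less_one_if_inside_disc) (auto simp: generalized_liouville_series_def)
  obtain A where A: "minimal_annihilator A \<alpha>"
    using assms(3) by (metis algebraicE' minimal_annihilator_exists)
  obtain C \<rho> q where C: "1 \<le> C" "1 \<le> \<rho>" and q: "0 < q" "q < 1"
    and coeffs: "\<And>k. \<bar>real_of_int (fps_nth f k)\<bar> \<le> C * \<rho> ^ k"
    and terms: "\<And>k. cmod (of_int (fps_nth f k) * \<alpha> ^ k) \<le> C * q ^ k"
    using geometric_coefficient_bounds[OF assms(4)] by metis
  define L where "L = nat \<lceil>2 * C * \<rho>\<rceil>"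
  have L: "2 * C * \<rho> \<le> real L" unfolding L_def by linarith
  have one: "1 \<le> C * \<rho>" using mult_mono[OF C] C by simp
  obtain B where B: "\<And>n. 1 \<le> n \<Longrightarrow> norm (real (s (n + 1)) / real (t n)) \<le> B"
    using seq(5) unfolding bounded_iff by auto
  define b where "b = nat \<lceil>B\<rceil>"
  interpret field_approximations A \<alpha> "eval_fps (complex_fps f) \<alpha>" "trunc_poly f s" s t L b
    "C / (1 - q)" q
  proof
    show "1 \<le> L" using L one by linarith
    show "0 < C / (1 - q)" using C q by simp
    fix n :: nat assume n: "1 \<le> n"
    have "len (trunc_poly f s n) \<le> (2 * C * \<rho>) ^ (s n + 1)"
      using coeffs C by (intro len_trunc_poly)
    also have "\<dots> \<le> real L ^ (s n + 1)" using L one by (intro power_mono) auto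
    finally show "len (trunc_poly f s n) \<le> real (L ^ (s n + 1))" by simp
    show "cmod (eval_fps (complex_fps f) \<alpha> - ev (trunc_poly f s n) \<alpha>) \<le> C / (1 - q) * q ^ t n"
      unfolding ev_trunc_poly by (intro truncation_error assms q terms n)
    show "t n \<le> s (n + 1)" using seq(2)[of "n + 1"] by simp
    have "0 < real (t n)" using seq(1)[OF n] by simp
    then have "real (s (n + 1)) \<le> B * real (t n)" using B[OF n] by (simp add: field_simps)
    also have "\<dots> \<le> real b * real (t n)" unfolding b_def by (intro mult_right_mono) linarith+
    finally show "s (n + 1) \<le> b * t n" by (metis of_nat_le_iff of_nat_mult)
  qed (use A \<alpha> q seq degree_trunc_poly in auto)
  have \<beta>_eq: "\<beta> = (\<lambda>n. truncation f s n \<alpha>)" by (simp add: fun_eq_iff \<beta>_def ev_trunc_poly)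
  interpret nonstationary_field_approximations A \<alpha> "eval_fps (complex_fps f) \<alpha>" "trunc_poly f s" s t L b
    "C / (1 - q)" q
  proof
    show "infinite (\<beta> ` {1..})"
    proof
      assume "finite (\<beta> ` {1..})"
      then obtain n0 where n0: "n0 \<ge> 1" "\<And>n. n \<ge> n0 \<Longrightarrow> \<beta> n = eval_fps (complex_fps f) \<alpha>"
        using eventually_constant_if_finite_range by blast
      \<comment> \<open>A nonzero block beyond n0 would make two consecutive truncations differ.\<close>
      have "n \<le> n0" if "n \<ge> 1" "block f s t n \<alpha> \<noteq> 0" for n
      proof (rule ccontr)
        assume "\<not> n \<le> n0"
        then obtain k where k: "n = Suc k" "k \<ge> n0" by (cases n) auto
        then have "truncation f s (Suc k) \<alpha> = truncation f s k \<alpha>"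
          using n0(2)[of k] n0(2)[of "Suc k"] by (simp add: \<beta>_eq)
        then show False using truncation_step[OF assms(2), of k \<alpha>] k n0(1) that(2) by simp
      qed
      then have "{n. n \<ge> 1 \<and> block f s t n \<alpha> \<noteq> 0} \<subseteq> {..n0}" by auto
      then show False using assms(5) finite_subset by blast
    qed
  qed
  show ?thesis
    using U_number_of_first_recurring_degree unfolding degree_recurs_def[abs_def] \<beta>_eq .
qed

end
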